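(* Let $\mathcal{A}$ be an abelian length category and $\mathcal{W}$ a wide subcategory of $\mathcal{A}$. Then the Hasse quiver of $\mathsf{ice}\,\mathcal{A}$ contains the Hasse quiver of $\mathsf{tors}\,\mathcal{W}$ as a full subquiver. That is, $\mathsf{tors}\,\mathcal{W}\subseteq\mathsf{ice}\,\mathcal{A}$, and for $\mathcal{T},\mathcal{U}\in\mathsf{tors}\,\mathcal{W}$ there is an arrow $\mathcal{T}\to\mathcal{U}$ in the Hasse quiver of $\mathsf{tors}\,\mathcal{W}$ if and only if there is an arrow $\mathcal{T}\to\mathcal{U}$ in the Hasse quiver of $\mathsf{ice}\,\mathcal{A}$.
   Context: All categories are skeletally small; an abelian length category is an abelian category in which every object has finite length. Subcategories are full, closed under isomorphisms, and contain the zero object. A subcategory $\mathcal{C}$ of $\mathcal{A}$ is wide if closed under extensions, and under kernels and cokernels (in $\mathcal{A}$) of morphisms between objects of $\mathcal{C}$ (it is then itself an abelian length category); ICE-closed if closed under extensions, and under images and cokernels (in $\mathcal{A}$) of morphisms between objects of $\mathcal{C}$. A torsion class in an abelian length category $\mathcal{W}$ is a subcategory closed under extensions and under quotients in $\mathcal{W}$. $\mathsf{ice}\,\mathcal{A}$ is the poset of ICE-closed subcategories of $\mathcal{A}$ and $\mathsf{tors}\,\mathcal{W}$ the poset of torsion classes in $\mathcal{W}$, both ordered by inclusion. The Hasse quiver of a poset $P$ has vertex set $P$ and an arrow $p\to q$ whenever $p>q$ and there is no $r\in P$ with $p>r>q$. *)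

theory Defs
  imports "HOL-Algebra.Group" "Graph_Theory.Digraph_Component"
begin

section \<open>Categories\<close>

text \<open>
  Objects and arrows range over carrier sets inside HOL types, so every category is small.
  \<open>g \<cdot> f\<close> is ``first \<open>f\<close>, then \<open>g\<close>'' and is meaningful only if \<open>cat_cod f = cat_dom g\<close>;
  the addition is meaningful only on parallel arrows.
\<close>

record ('o, 'm) precat =
  cat_obj :: "'o set"
  cat_arr :: "'m set"
  cat_dom :: "'m \<Rightarrow> 'o"
  cat_cod :: "'m \<Rightarrow> 'o"
  cat_id :: "'o \<Rightarrow> 'm"
  cat_comp :: "'m \<Rightarrow> 'm \<Rightarrow> 'm"  (infixl "\<cdot>\<index>" 70)
  cat_add :: "'m \<Rightarrow> 'm \<Rightarrow> 'm"  (infixl "\<boxplus>\<index>" 65)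
  cat_zero :: "'o \<Rightarrow> 'o \<Rightarrow> 'm"

definition cat_hom :: "('o, 'm) precat \<Rightarrow> 'o \<Rightarrow> 'o \<Rightarrow> 'm set" where
  "cat_hom A X Y = {f \<in> cat_arr A. cat_dom A f = X \<and> cat_cod A f = Y}"

locale category =
  fixes A :: "('o, 'm) precat" (structure)
  assumes dom_obj: "f \<in> cat_arr A \<Longrightarrow> cat_dom A f \<in> cat_obj A"
    and cod_obj: "f \<in> cat_arr A \<Longrightarrow> cat_cod A f \<in> cat_obj A"
    and id_hom: "X \<in> cat_obj A \<Longrightarrow> cat_id A X \<in> cat_hom A X X"
    and comp_hom: "\<lbrakk>f \<in> cat_hom A X Y; g \<in> cat_hom A Y Z\<rbrakk> \<Longrightarrow> g \<cdot> f \<in> cat_hom A X Z"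
    and comp_id_right: "f \<in> cat_hom A X Y \<Longrightarrow> f \<cdot> cat_id A X = f"
    and comp_id_left: "f \<in> cat_hom A X Y \<Longrightarrow> cat_id A Y \<cdot> f = f"
    and comp_assoc: "\<lbrakk>f \<in> cat_hom A W X; g \<in> cat_hom A X Y; h \<in> cat_hom A Y Z\<rbrakk>
      \<Longrightarrow> h \<cdot> (g \<cdot> f) = (h \<cdot> g) \<cdot> f"

definition is_iso :: "('o, 'm) precat \<Rightarrow> 'm \<Rightarrow> bool" where
  "is_iso A f \<longleftrightarrow> f \<in> cat_arr A \<and>
    (\<exists>g \<in> cat_hom A (cat_cod A f) (cat_dom A f).
      g \<cdot>\<^bsub>A\<^esub> f = cat_id A (cat_dom A f) \<and> f \<cdot>\<^bsub>A\<^esub> g = cat_id A (cat_cod A f))"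

definition is_mono :: "('o, 'm) precat \<Rightarrow> 'm \<Rightarrow> bool" where
  "is_mono A f \<longleftrightarrow> f \<in> cat_arr A \<and>
    (\<forall>W. \<forall>g \<in> cat_hom A W (cat_dom A f). \<forall>h \<in> cat_hom A W (cat_dom A f).
      f \<cdot>\<^bsub>A\<^esub> g = f \<cdot>\<^bsub>A\<^esub> h \<longrightarrow> g = h)"

definition is_epi :: "('o, 'm) precat \<Rightarrow> 'm \<Rightarrow> bool" where
  "is_epi A f \<longleftrightarrow> f \<in> cat_arr A \<and>
    (\<forall>Z. \<forall>g \<in> cat_hom A (cat_cod A f) Z. \<forall>h \<in> cat_hom A (cat_cod A f) Z.
      g \<cdot>\<^bsub>A\<^esub> f = h \<cdot>\<^bsub>A\<^esub> f \<longrightarrow> g = h)"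

definition is_zero_object :: "('o, 'm) precat \<Rightarrow> 'o \<Rightarrow> bool" where
  "is_zero_object A Z \<longleftrightarrow> Z \<in> cat_obj A \<and>
    (\<forall>X \<in> cat_obj A. (\<exists>!f. f \<in> cat_hom A X Z) \<and> (\<exists>!f. f \<in> cat_hom A Z X))"


section \<open>Abelian length categories\<close>

definition hom_group :: "('o, 'm) precat \<Rightarrow> 'o \<Rightarrow> 'o \<Rightarrow> 'm monoid" where
  "hom_group A X Y = \<lparr>carrier = cat_hom A X Y, monoid.mult = cat_add A, one = cat_zero A X Y\<rparr>"

locale preadditive_category = category +
  assumes hom_comm_group:
      "\<lbrakk>X \<in> cat_obj A; Y \<in> cat_obj A\<rbrakk> \<Longrightarrow> comm_group (hom_group A X Y)"
    and comp_add_right: "\<lbrakk>f \<in> cat_hom A X Y; f' \<in> cat_hom A X Y; g \<in> cat_hom A Y Z\<rbrakk>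
      \<Longrightarrow> g \<cdot> (f \<boxplus> f') = (g \<cdot> f) \<boxplus> (g \<cdot> f')"
    and comp_add_left: "\<lbrakk>f \<in> cat_hom A X Y; g \<in> cat_hom A Y Z; g' \<in> cat_hom A Y Z\<rbrakk>
      \<Longrightarrow> (g \<boxplus> g') \<cdot> f = (g \<cdot> f) \<boxplus> (g' \<cdot> f)"

locale additive_category = preadditive_category +
  assumes ex_zero_object: "\<exists>Z. is_zero_object A Z"
    and ex_biproduct: "\<lbrakk>X \<in> cat_obj A; Y \<in> cat_obj A\<rbrakk> \<Longrightarrow>
      \<exists>P. \<exists>i \<in> cat_hom A X P. \<exists>j \<in> cat_hom A Y P. \<exists>p \<in> cat_hom A P X. \<exists>q \<in> cat_hom A P Y.
        p \<cdot> i = cat_id A X \<and> q \<cdot> j = cat_id A Y \<and>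
        q \<cdot> i = cat_zero A X Y \<and> p \<cdot> j = cat_zero A Y X \<and>
        (i \<cdot> p) \<boxplus> (j \<cdot> q) = cat_id A P"

definition is_kernel :: "('o, 'm) precat \<Rightarrow> 'm \<Rightarrow> 'm \<Rightarrow> bool" where
  "is_kernel A f k \<longleftrightarrow> f \<in> cat_arr A \<and> k \<in> cat_arr A \<and> cat_cod A k = cat_dom A f \<and>
    f \<cdot>\<^bsub>A\<^esub> k = cat_zero A (cat_dom A k) (cat_cod A f) \<and>
    (\<forall>T. \<forall>t \<in> cat_hom A T (cat_dom A f). f \<cdot>\<^bsub>A\<^esub> t = cat_zero A T (cat_cod A f) \<longrightarrow>
      (\<exists>!u. u \<in> cat_hom A T (cat_dom A k) \<and> k \<cdot>\<^bsub>A\<^esub> u = t))"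

definition is_cokernel :: "('o, 'm) precat \<Rightarrow> 'm \<Rightarrow> 'm \<Rightarrow> bool" where
  "is_cokernel A f c \<longleftrightarrow> f \<in> cat_arr A \<and> c \<in> cat_arr A \<and> cat_dom A c = cat_cod A f \<and>
    c \<cdot>\<^bsub>A\<^esub> f = cat_zero A (cat_dom A f) (cat_cod A c) \<and>
    (\<forall>T. \<forall>t \<in> cat_hom A (cat_cod A f) T. t \<cdot>\<^bsub>A\<^esub> f = cat_zero A (cat_dom A f) T \<longrightarrow>
      (\<exists>!u. u \<in> cat_hom A (cat_cod A c) T \<and> u \<cdot>\<^bsub>A\<^esub> c = t))"

locale abelian_category = additive_category +
  assumes ex_kernel: "f \<in> cat_arr A \<Longrightarrow> \<exists>k. is_kernel A f k"
    and ex_cokernel: "f \<in> cat_arr A \<Longrightarrow> \<exists>c. is_cokernel A f c"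
    and mono_is_kernel: "is_mono A f \<Longrightarrow> \<exists>g. is_kernel A g f"
    and epi_is_cokernel: "is_epi A f \<Longrightarrow> \<exists>g. is_cokernel A g f"

definition short_exact :: "('o, 'm) precat \<Rightarrow> 'm \<Rightarrow> 'm \<Rightarrow> bool" where
  "short_exact A f g \<longleftrightarrow> is_kernel A g f \<and> is_cokernel A f g"

definition is_image :: "('o, 'm) precat \<Rightarrow> 'm \<Rightarrow> 'm \<Rightarrow> bool" where
  "is_image A f i \<longleftrightarrow> (\<exists>c. is_cokernel A f c \<and> is_kernel A c i)"

definition simple_object :: "('o, 'm) precat \<Rightarrow> 'o \<Rightarrow> bool" where
  "simple_object A S \<longleftrightarrow> S \<in> cat_obj A \<and> \<not> is_zero_object A S \<and>
    (\<forall>m. is_mono A m \<and> cat_cod A m = S \<longrightarrow> is_zero_object A (cat_dom A m) \<or> is_iso A m)"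

text \<open>
  Existence of a composition series \<open>0 = Y 0 \<rightarrow> Y 1 \<rightarrow> \<dots> \<rightarrow> Y n = X\<close> of monomorphisms \<open>f i\<close>
  with simple cokernels.
\<close>

definition finite_length :: "('o, 'm) precat \<Rightarrow> 'o \<Rightarrow> bool" where
  "finite_length A X \<longleftrightarrow>
    (\<exists>(n :: nat) Y f. is_zero_object A (Y 0) \<and> Y n = X \<and>
      (\<forall>i < n. f i \<in> cat_hom A (Y i) (Y (Suc i)) \<and>
        (\<exists>q. short_exact A (f i) q \<and> simple_object A (cat_cod A q))))"

locale abelian_length_category = abelian_category +
  assumes finite_length: "X \<in> cat_obj A \<Longrightarrow> finite_length A X"


section \<open>Subcategories\<close>

text \<open>Subcategories are full, so they are given by their sets of objects.\<close>

definition subcategory :: "('o, 'm) precat \<Rightarrow> 'o set \<Rightarrow> bool" where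
  "subcategory A C \<longleftrightarrow> C \<subseteq> cat_obj A \<and> (\<exists>Z \<in> C. is_zero_object A Z) \<and>
    (\<forall>f. is_iso A f \<and> cat_dom A f \<in> C \<longrightarrow> cat_cod A f \<in> C)"

definition full_subcat :: "('o, 'm) precat \<Rightarrow> 'o set \<Rightarrow> ('o, 'm) precat" where
  "full_subcat A C =
    A\<lparr>cat_obj := C, cat_arr := {f \<in> cat_arr A. cat_dom A f \<in> C \<and> cat_cod A f \<in> C}\<rparr>"

definition extension_closed :: "('o, 'm) precat \<Rightarrow> 'o set \<Rightarrow> bool" where
  "extension_closed A C \<longleftrightarrow>
    (\<forall>f g. short_exact A f g \<and> cat_dom A f \<in> C \<and> cat_cod A g \<in> C \<longrightarrow> cat_cod A f \<in> C)"

definition kernel_closed :: "('o, 'm) precat \<Rightarrow> 'o set \<Rightarrow> bool" where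
  "kernel_closed A C \<longleftrightarrow>
    (\<forall>f k. is_kernel A f k \<and> cat_dom A f \<in> C \<and> cat_cod A f \<in> C \<longrightarrow> cat_dom A k \<in> C)"

definition cokernel_closed :: "('o, 'm) precat \<Rightarrow> 'o set \<Rightarrow> bool" where
  "cokernel_closed A C \<longleftrightarrow>
    (\<forall>f c. is_cokernel A f c \<and> cat_dom A f \<in> C \<and> cat_cod A f \<in> C \<longrightarrow> cat_cod A c \<in> C)"

definition image_closed :: "('o, 'm) precat \<Rightarrow> 'o set \<Rightarrow> bool" where
  "image_closed A C \<longleftrightarrow>
    (\<forall>f i. is_image A f i \<and> cat_dom A f \<in> C \<and> cat_cod A f \<in> C \<longrightarrow> cat_dom A i \<in> C)"

definition quotient_closed :: "('o, 'm) precat \<Rightarrow> 'o set \<Rightarrow> bool" where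
  "quotient_closed A C \<longleftrightarrow> (\<forall>e. is_epi A e \<and> cat_dom A e \<in> C \<longrightarrow> cat_cod A e \<in> C)"

definition wide_subcategory :: "('o, 'm) precat \<Rightarrow> 'o set \<Rightarrow> bool" where
  "wide_subcategory A W \<longleftrightarrow>
    subcategory A W \<and> extension_closed A W \<and> kernel_closed A W \<and> cokernel_closed A W"

definition ICE_closed :: "('o, 'm) precat \<Rightarrow> 'o set \<Rightarrow> bool" where
  "ICE_closed A C \<longleftrightarrow>
    subcategory A C \<and> image_closed A C \<and> cokernel_closed A C \<and> extension_closed A C"

definition torsion_class :: "('o, 'm) precat \<Rightarrow> 'o set \<Rightarrow> bool" where
  "torsion_class A T \<longleftrightarrow> subcategory A T \<and> extension_closed A T \<and> quotient_closed A T"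

definition ice :: "('o, 'm) precat \<Rightarrow> 'o set set" where
  "ice A = {C. ICE_closed A C}"

text \<open>
  For a wide subcategory \<open>W\<close> of \<open>A\<close>, the torsion classes in \<open>W\<close> are \<open>tors (full_subcat A W)\<close>:
  short exact sequences, epimorphisms and isomorphisms are those of the category \<open>W\<close>.
\<close>

definition tors :: "('o, 'm) precat \<Rightarrow> 'o set set" where
  "tors A = {T. torsion_class A T}"


section \<open>Hasse quivers\<close>

definition hasse_quiver :: "'a :: order set \<Rightarrow> ('a, 'a \<times> 'a) pre_digraph" where
  "hasse_quiver P = \<lparr>
    verts = P,
    arcs = {(p, q). p \<in> P \<and> q \<in> P \<and> p > q \<and> \<not> (\<exists>r \<in> P. p > r \<and> r > q)},
    tail = fst,
    head = snd\<rparr>"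

end

theory Submission
  imports Defs
begin

text \<open>
  That \<open>tors W \<subseteq> ice A\<close> is immediate, since images and cokernels of maps in the wide subcategory
  \<open>W\<close> stay in \<open>W\<close> and are quotients there. An arrow of the Hasse quiver of \<open>ice A\<close> between torsion
  classes of \<open>W\<close> is then an arrow in \<open>tors W\<close>. The content is the converse
  (\<open>ICE_closed_between_cover\<close>): if \<open>T\<close> covers \<open>U\<close> in \<open>tors W\<close>, then every ICE-closed \<open>C\<close> with
  \<open>U \<subseteq> C \<subseteq> T\<close> and \<open>C \<noteq> U\<close> is all of \<open>T\<close>.

  Let \<open>B\<close> be an object of shortest length in \<open>T\<close> outside \<open>U\<close>; it is the brick labelling the
  cover. Its proper quotients in \<open>W\<close> lie in \<open>U\<close>, and there is no nonzero map from \<open>U\<close> to \<open>B\<close>.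
  For any family \<open>F\<close> of objects of \<open>W\<close>, the objects of \<open>T\<close> without nonzero maps to \<open>F\<close> form a
  torsion class (\<open>left_perp_tors\<close>), and the covering relation forces this class to be \<open>U\<close> or \<open>T\<close>
  as soon as it contains \<open>U\<close>. Applied to \<open>F = {B}\<close>, this gives an epimorphism \<open>X \<rightarrow> B\<close> for every
  \<open>X\<close> in \<open>T\<close> outside \<open>U\<close> (\<open>ex_epi_to_B\<close>). Applied to the objects that receive no nonzero map
  from \<open>U\<close> or \<open>B\<close>, it shows that every nonzero object of \<open>T\<close> receives a nonzero map from \<open>B\<close> or
  from an object of \<open>U\<close> (\<open>ex_nonzero_map_into\<close>).

  If now \<open>X\<close> is a shortest object of \<open>C\<close> outside \<open>U\<close>, closure of \<open>C\<close> under cokernels excludes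
  nonzero maps \<open>U \<rightarrow> X\<close>, so there is a nonzero map \<open>B \<rightarrow> X\<close>, necessarily mono. The composite
  \<open>X \<rightarrow> B \<rightarrow> X\<close> has image \<open>B\<close>, so \<open>B\<close> is in \<open>C\<close> by closure under images
  (\<open>B_in_ICE_closed\<close>). Finally every object of \<open>T\<close> is an iterated extension of objects of \<open>U\<close> and
  copies of \<open>B\<close>, so closure under extensions gives \<open>T \<subseteq> C\<close> (\<open>T_subset_ICE_closed\<close>).

  Length enters only through the fact that proper subobjects and proper quotients are shorter.
  This follows from superadditivity of the least length of a composition series on short exact
  sequences (\<open>short_exact_len\<close>), without the Jordan-Hoelder theorem.
\<close>

section \<open>Preadditive categories\<close>

context category
begin

abbreviation Hom :: "'o \<Rightarrow> 'o \<Rightarrow> 'm set" where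
  "Hom \<equiv> cat_hom A"

lemma HomD:
  assumes "f \<in> Hom X Y"
  shows "X \<in> cat_obj A" "Y \<in> cat_obj A" "f \<in> cat_arr A" "cat_dom A f = X" "cat_cod A f = Y"
  using assms dom_obj cod_obj by (auto simp: cat_hom_def)

lemma arr_Hom: "f \<in> cat_arr A \<Longrightarrow> f \<in> Hom (cat_dom A f) (cat_cod A f)"
  by (simp add: cat_hom_def)

lemma is_epi_cancel:
  "\<lbrakk>is_epi A e; e \<in> Hom X Y; g \<in> Hom Y Z; h \<in> Hom Y Z; g \<cdot> e = h \<cdot> e\<rbrakk> \<Longrightarrow> g = h"
  by (auto simp: is_epi_def cat_hom_def)

lemma is_mono_cancel:
  "\<lbrakk>is_mono A m; m \<in> Hom X Y; g \<in> Hom Z X; h \<in> Hom Z X; m \<cdot> g = m \<cdot> h\<rbrakk> \<Longrightarrow> g = h"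
  by (auto simp: is_mono_def cat_hom_def)

lemma is_isoE:
  assumes "is_iso A f" "f \<in> Hom X Y"
  obtains g where "g \<in> Hom Y X" "g \<cdot> f = cat_id A X" "f \<cdot> g = cat_id A Y"
  using assms by (auto simp: is_iso_def HomD)

lemma is_iso_imp_mono:
  assumes "is_iso A f"
  shows "is_mono A f"
proof -
  have f: "f \<in> Hom (cat_dom A f) (cat_cod A f)"
    using assms by (auto simp: is_iso_def cat_hom_def)
  obtain i where i: "i \<in> Hom (cat_cod A f) (cat_dom A f)" "i \<cdot> f = cat_id A (cat_dom A f)"
    using is_isoE[OF assms f] by blast
  have "g = h" if "g \<in> Hom Z (cat_dom A f)" "h \<in> Hom Z (cat_dom A f)" "f \<cdot> g = f \<cdot> h" for Z g h
    by (metis comp_assoc comp_id_left f i that)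
  then show ?thesis
    using HomD(3)[OF f] by (auto simp: is_mono_def)
qed

lemma is_iso_imp_epi:
  assumes "is_iso A f"
  shows "is_epi A f"
proof -
  have f: "f \<in> Hom (cat_dom A f) (cat_cod A f)"
    using assms by (auto simp: is_iso_def cat_hom_def)
  obtain i where i: "i \<in> Hom (cat_cod A f) (cat_dom A f)" "f \<cdot> i = cat_id A (cat_cod A f)"
    using is_isoE[OF assms f] by blast
  have "g = h" if "g \<in> Hom (cat_cod A f) Z" "h \<in> Hom (cat_cod A f) Z" "g \<cdot> f = h \<cdot> f" for Z g h
    by (metis comp_assoc comp_id_right f i that)
  then show ?thesis
    using HomD(3)[OF f] by (auto simp: is_epi_def)
qed

lemma is_mono_comp:
  assumes "f \<in> Hom X Y" "g \<in> Hom Y Z" "is_mono A f" "is_mono A g"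
  shows "is_mono A (g \<cdot> f)"
proof -
  have gf: "g \<cdot> f \<in> Hom X Z" using assms comp_hom by blast
  have "a = b" if "a \<in> Hom V X" "b \<in> Hom V X" "(g \<cdot> f) \<cdot> a = (g \<cdot> f) \<cdot> b" for V a b
  proof -
    have "g \<cdot> (f \<cdot> a) = g \<cdot> (f \<cdot> b)" using that comp_assoc assms by simp
    then have "f \<cdot> a = f \<cdot> b" using is_mono_cancel[OF assms(4,2)] comp_hom that assms(1) by blast
    then show ?thesis using is_mono_cancel[OF assms(3,1)] that by blast
  qed
  then show ?thesis using HomD[OF gf] by (auto simp: is_mono_def)
qed

lemma is_epi_comp:
  assumes "f \<in> Hom X Y" "g \<in> Hom Y Z" "is_epi A f" "is_epi A g"
  shows "is_epi A (g \<cdot> f)"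
proof -
  have gf: "g \<cdot> f \<in> Hom X Z" using assms comp_hom by blast
  have "a = b" if "a \<in> Hom Z V" "b \<in> Hom Z V" "a \<cdot> (g \<cdot> f) = b \<cdot> (g \<cdot> f)" for V a b
  proof -
    have "(a \<cdot> g) \<cdot> f = (b \<cdot> g) \<cdot> f" using that comp_assoc[OF assms(1,2)] by simp
    then have "a \<cdot> g = b \<cdot> g" using is_epi_cancel[OF assms(3,1)] comp_hom that assms(2) by blast
    then show ?thesis using is_epi_cancel[OF assms(4,2)] that by blast
  qed
  then show ?thesis using HomD[OF gf] by (auto simp: is_epi_def)
qed

lemma is_mono_right_factor:
  assumes "f \<in> Hom X Y" "g \<in> Hom Y Z" "is_mono A (g \<cdot> f)"
  shows "is_mono A f"
proof -
  have gf: "g \<cdot> f \<in> Hom X Z" using assms comp_hom by blast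
  have "a = b" if "a \<in> Hom V X" "b \<in> Hom V X" "f \<cdot> a = f \<cdot> b" for V a b
  proof -
    have "(g \<cdot> f) \<cdot> a = (g \<cdot> f) \<cdot> b" using that comp_assoc[OF _ assms(1,2)] by metis
    then show ?thesis using is_mono_cancel[OF assms(3) gf] that by blast
  qed
  then show ?thesis using HomD[OF assms(1)] by (auto simp: is_mono_def)
qed

end

context preadditive_category
begin

lemma zero_hom: "\<lbrakk>X \<in> cat_obj A; Y \<in> cat_obj A\<rbrakk> \<Longrightarrow> cat_zero A X Y \<in> Hom X Y"
  using hom_comm_group[of X Y] monoid.one_closed[of "hom_group A X Y"]
  by (auto simp: hom_group_def comm_group_def comm_monoid_def group_def)

lemma add_hom: "\<lbrakk>f \<in> Hom X Y; g \<in> Hom X Y\<rbrakk> \<Longrightarrow> f \<boxplus> g \<in> Hom X Y"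
  using hom_comm_group[OF HomD(1,2)[of f X Y]] monoid.m_closed[of "hom_group A X Y" f g]
  by (auto simp: hom_group_def comm_group_def comm_monoid_def group_def)

lemma add_zero:
  assumes "f \<in> Hom X Y"
  shows "f \<boxplus> cat_zero A X Y = f" "cat_zero A X Y \<boxplus> f = f"
  using hom_comm_group[OF HomD(1,2)[OF assms]] assms
    monoid.r_one[of "hom_group A X Y" f] monoid.l_one[of "hom_group A X Y" f]
  by (auto simp: hom_group_def comm_group_def comm_monoid_def group_def)

lemma add_right_cancel:
  assumes "f \<in> Hom X Y" "g \<in> Hom X Y" "h \<in> Hom X Y" "f \<boxplus> h = g \<boxplus> h"
  shows "f = g"
  using hom_comm_group[OF HomD(1,2)[OF assms(1)]] assms
    group.right_cancel[of "hom_group A X Y" h f g]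
  by (auto simp: hom_group_def comm_group_def)

lemma ex_neg:
  assumes "f \<in> Hom X Y"
  shows "\<exists>g \<in> Hom X Y. f \<boxplus> g = cat_zero A X Y"
proof -
  have "group (hom_group A X Y)"
    using hom_comm_group[OF HomD(1,2)[OF assms]] by (simp add: comm_group_def)
  from group.r_inv_ex[OF this, of f] show ?thesis
    using assms by (auto simp: hom_group_def)
qed

lemma comp_zero_right:
  assumes "g \<in> Hom Y Z" "X \<in> cat_obj A"
  shows "g \<cdot> cat_zero A X Y = cat_zero A X Z"
proof -
  have z: "cat_zero A X Y \<in> Hom X Y" "cat_zero A X Z \<in> Hom X Z"
    using zero_hom HomD[OF assms(1)] assms(2) by auto
  have gz: "g \<cdot> cat_zero A X Y \<in> Hom X Z" using comp_hom z assms by blast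
  have "(g \<cdot> cat_zero A X Y) \<boxplus> (g \<cdot> cat_zero A X Y) = g \<cdot> (cat_zero A X Y \<boxplus> cat_zero A X Y)"
    using comp_add_right z assms by simp
  also have "\<dots> = cat_zero A X Z \<boxplus> (g \<cdot> cat_zero A X Y)"
    using add_zero z gz by simp
  finally show ?thesis using add_right_cancel gz z by blast
qed

lemma comp_zero_left:
  assumes "f \<in> Hom X Y" "Z \<in> cat_obj A"
  shows "cat_zero A Y Z \<cdot> f = cat_zero A X Z"
proof -
  have z: "cat_zero A Y Z \<in> Hom Y Z" "cat_zero A X Z \<in> Hom X Z"
    using zero_hom HomD[OF assms(1)] assms(2) by auto
  have gz: "cat_zero A Y Z \<cdot> f \<in> Hom X Z" using comp_hom z assms by blast
  have "(cat_zero A Y Z \<cdot> f) \<boxplus> (cat_zero A Y Z \<cdot> f) = (cat_zero A Y Z \<boxplus> cat_zero A Y Z) \<cdot> f"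
    using comp_add_left z assms by simp
  also have "\<dots> = cat_zero A X Z \<boxplus> (cat_zero A Y Z \<cdot> f)"
    using add_zero z gz by simp
  finally show ?thesis using add_right_cancel gz z by blast
qed

lemma mono_comp_zero:
  "\<lbrakk>is_mono A m; m \<in> Hom Y Z; f \<in> Hom X Y; m \<cdot> f = cat_zero A X Z\<rbrakk> \<Longrightarrow> f = cat_zero A X Y"
  using is_mono_cancel[of m Y Z f X "cat_zero A X Y"] zero_hom comp_zero_right HomD by metis

lemma epi_comp_zero:
  "\<lbrakk>is_epi A e; e \<in> Hom X Y; f \<in> Hom Y Z; f \<cdot> e = cat_zero A X Z\<rbrakk> \<Longrightarrow> f = cat_zero A Y Z"
  using is_epi_cancel[of e X Y f Z "cat_zero A Y Z"] zero_hom comp_zero_left HomD by metis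

lemma monoI:
  assumes f: "f \<in> Hom X Y"
    and zero: "\<And>W g. \<lbrakk>g \<in> Hom W X; f \<cdot> g = cat_zero A W Y\<rbrakk> \<Longrightarrow> g = cat_zero A W X"
  shows "is_mono A f"
proof -
  have "g = h" if gh: "g \<in> Hom W X" "h \<in> Hom W X" "f \<cdot> g = f \<cdot> h" for W g h
  proof -
    obtain n where n: "n \<in> Hom W X" "h \<boxplus> n = cat_zero A W X" using ex_neg gh by blast
    have "f \<cdot> (g \<boxplus> n) = f \<cdot> (h \<boxplus> n)" using comp_add_right f gh n by metis
    also have "\<dots> = cat_zero A W Y" using comp_zero_right f n HomD(1)[OF gh(1)] by simp
    finally have "g \<boxplus> n = h \<boxplus> n" using zero n add_hom gh by metis
    then show ?thesis using add_right_cancel gh n by blast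
  qed
  then show ?thesis using HomD[OF f] by (auto simp: is_mono_def)
qed

lemma epiI:
  assumes f: "f \<in> Hom X Y"
    and zero: "\<And>Z g. \<lbrakk>g \<in> Hom Y Z; g \<cdot> f = cat_zero A X Z\<rbrakk> \<Longrightarrow> g = cat_zero A Y Z"
  shows "is_epi A f"
proof -
  have "g = h" if gh: "g \<in> Hom Y Z" "h \<in> Hom Y Z" "g \<cdot> f = h \<cdot> f" for Z g h
  proof -
    obtain n where n: "n \<in> Hom Y Z" "h \<boxplus> n = cat_zero A Y Z" using ex_neg gh by blast
    have "(g \<boxplus> n) \<cdot> f = (h \<boxplus> n) \<cdot> f" using comp_add_left f gh n by metis
    also have "\<dots> = cat_zero A X Z" using comp_zero_left f n HomD(2)[OF gh(1)] by simp
    finally have "g \<boxplus> n = h \<boxplus> n" using zero n add_hom gh by metis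
    then show ?thesis using add_right_cancel gh n by blast
  qed
  then show ?thesis using HomD[OF f] by (auto simp: is_epi_def)
qed

lemma hom_to_zero_object: "\<lbrakk>is_zero_object A Z; f \<in> Hom X Z\<rbrakk> \<Longrightarrow> f = cat_zero A X Z"
  using zero_hom[of X Z] HomD[of f X Z] by (auto simp: is_zero_object_def)

lemma hom_from_zero_object: "\<lbrakk>is_zero_object A Z; f \<in> Hom Z X\<rbrakk> \<Longrightarrow> f = cat_zero A Z X"
  using zero_hom[of Z X] HomD[of f Z X] by (auto simp: is_zero_object_def)

lemma is_zero_objectI:
  assumes "Z \<in> cat_obj A" "cat_id A Z = cat_zero A Z Z"
  shows "is_zero_object A Z"
proof -
  have "f = cat_zero A X Z" if "f \<in> Hom X Z" for X f
    using comp_id_left[OF that] comp_zero_left[OF that assms(1)] assms(2) by simp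
  moreover have "f = cat_zero A Z X" if "f \<in> Hom Z X" for X f
    using comp_id_right[OF that] comp_zero_right[OF that assms(1)] assms(2) by simp
  ultimately show ?thesis
    using assms(1) zero_hom unfolding is_zero_object_def by metis
qed

lemma mono_dom_zero:
  assumes "is_mono A m" "m \<in> Hom X Y" "m = cat_zero A X Y"
  shows "is_zero_object A X"
  using mono_comp_zero[OF assms(1,2) id_hom] comp_id_right[OF assms(2)] HomD[OF assms(2)]
    is_zero_objectI assms(3) by metis

lemma epi_cod_zero:
  assumes "is_epi A e" "e \<in> Hom X Y" "e = cat_zero A X Y"
  shows "is_zero_object A Y"
  using epi_comp_zero[OF assms(1,2) id_hom] comp_id_left[OF assms(2)] HomD[OF assms(2)]
    is_zero_objectI assms(3) by metis

lemma epi_to_zero_object: "\<lbrakk>is_zero_object A Z; f \<in> Hom X Z\<rbrakk> \<Longrightarrow> is_epi A f"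
  by (rule epiI) (auto dest: hom_from_zero_object)


section \<open>Kernels and cokernels\<close>

lemma is_kernelD:
  assumes "is_kernel A f k" "f \<in> Hom X Y"
  shows "k \<in> Hom (cat_dom A k) X" "f \<cdot> k = cat_zero A (cat_dom A k) Y" "is_mono A k"
    and "\<lbrakk>t \<in> Hom V X; f \<cdot> t = cat_zero A V Y\<rbrakk> \<Longrightarrow> \<exists>u \<in> Hom V (cat_dom A k). k \<cdot> u = t"
proof -
  note f = HomD[OF assms(2)]
  show k: "k \<in> Hom (cat_dom A k) X" and fk: "f \<cdot> k = cat_zero A (cat_dom A k) Y"
    using assms(1) f by (auto simp: is_kernel_def cat_hom_def)
  have uniq: "\<exists>!u. u \<in> Hom V (cat_dom A k) \<and> k \<cdot> u = t"
    if "t \<in> Hom V X" "f \<cdot> t = cat_zero A V Y" for V t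
    using assms(1) f that by (auto simp: is_kernel_def)
  then show "\<exists>u \<in> Hom V (cat_dom A k). k \<cdot> u = t"
    if "t \<in> Hom V X" "f \<cdot> t = cat_zero A V Y" using that by blast
  show "is_mono A k"
  proof (rule monoI[OF k])
    fix V g assume g: "g \<in> Hom V (cat_dom A k)" "k \<cdot> g = cat_zero A V X"
    have V: "V \<in> cat_obj A" using HomD g by blast
    have "f \<cdot> cat_zero A V X = cat_zero A V Y" using comp_zero_right assms(2) V by blast
    moreover have "cat_zero A V (cat_dom A k) \<in> Hom V (cat_dom A k)"
      "k \<cdot> cat_zero A V (cat_dom A k) = cat_zero A V X"
      using zero_hom HomD[OF k] comp_zero_right[OF k] V by blast+
    ultimately show "g = cat_zero A V (cat_dom A k)"
      using uniq[of "cat_zero A V X" V] zero_hom V f(1) g by blast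
  qed
qed

lemma is_cokernelD:
  assumes "is_cokernel A f c" "f \<in> Hom X Y"
  shows "c \<in> Hom Y (cat_cod A c)" "c \<cdot> f = cat_zero A X (cat_cod A c)" "is_epi A c"
    and "\<lbrakk>t \<in> Hom Y V; t \<cdot> f = cat_zero A X V\<rbrakk> \<Longrightarrow> \<exists>u \<in> Hom (cat_cod A c) V. u \<cdot> c = t"
proof -
  note f = HomD[OF assms(2)]
  show c: "c \<in> Hom Y (cat_cod A c)" and cf: "c \<cdot> f = cat_zero A X (cat_cod A c)"
    using assms(1) f by (auto simp: is_cokernel_def cat_hom_def)
  have uniq: "\<exists>!u. u \<in> Hom (cat_cod A c) V \<and> u \<cdot> c = t"
    if "t \<in> Hom Y V" "t \<cdot> f = cat_zero A X V" for V t
    using assms(1) f that by (auto simp: is_cokernel_def)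
  then show "\<exists>u \<in> Hom (cat_cod A c) V. u \<cdot> c = t"
    if "t \<in> Hom Y V" "t \<cdot> f = cat_zero A X V" using that by blast
  show "is_epi A c"
  proof (rule epiI[OF c])
    fix V g assume g: "g \<in> Hom (cat_cod A c) V" "g \<cdot> c = cat_zero A Y V"
    have V: "V \<in> cat_obj A" using HomD g by blast
    have "cat_zero A Y V \<cdot> f = cat_zero A X V" using comp_zero_left assms(2) V by blast
    moreover have "cat_zero A (cat_cod A c) V \<in> Hom (cat_cod A c) V"
      "cat_zero A (cat_cod A c) V \<cdot> c = cat_zero A Y V"
      using zero_hom HomD[OF c] comp_zero_left[OF c] V by blast+
    ultimately show "g = cat_zero A (cat_cod A c) V"
      using uniq[of "cat_zero A Y V" V] zero_hom V f(2) g by blast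
  qed
qed

lemma is_kernelI:
  assumes f: "f \<in> Hom X Y" and k: "k \<in> Hom K X" "is_mono A k" "f \<cdot> k = cat_zero A K Y"
    and factor: "\<And>V t. \<lbrakk>t \<in> Hom V X; f \<cdot> t = cat_zero A V Y\<rbrakk> \<Longrightarrow> \<exists>u \<in> Hom V K. k \<cdot> u = t"
  shows "is_kernel A f k"
proof -
  have "\<exists>!u. u \<in> Hom V K \<and> k \<cdot> u = t" if "t \<in> Hom V X" "f \<cdot> t = cat_zero A V Y" for V t
    using factor[OF that] is_mono_cancel[OF k(2,1)] by metis
  then show ?thesis
    using HomD[OF f] HomD[OF k(1)] k(3) by (auto simp: is_kernel_def)
qed

lemma is_cokernelI:
  assumes f: "f \<in> Hom X Y" and c: "c \<in> Hom Y C" "is_epi A c" "c \<cdot> f = cat_zero A X C"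
    and factor: "\<And>V t. \<lbrakk>t \<in> Hom Y V; t \<cdot> f = cat_zero A X V\<rbrakk> \<Longrightarrow> \<exists>u \<in> Hom C V. u \<cdot> c = t"
  shows "is_cokernel A f c"
proof -
  have "\<exists>!u. u \<in> Hom C V \<and> u \<cdot> c = t" if "t \<in> Hom Y V" "t \<cdot> f = cat_zero A X V" for V t
    using factor[OF that] is_epi_cancel[OF c(2,1)] by metis
  then show ?thesis
    using HomD[OF f] HomD[OF c(1)] c(3) by (auto simp: is_cokernel_def)
qed

lemma is_cokernel_precomp_epi:
  assumes e: "e \<in> Hom X I" "is_epi A e" and m: "m \<in> Hom I Y" and c: "is_cokernel A (m \<cdot> e) c"
  shows "is_cokernel A m c"
proof -
  have me: "m \<cdot> e \<in> Hom X Y" using comp_hom e m by blast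
  note C = is_cokernelD[OF c me]
  have obj: "cat_cod A c \<in> cat_obj A" using HomD C(1) by blast
  show ?thesis
  proof (rule is_cokernelI[OF m C(1,3)])
    have "(c \<cdot> m) \<cdot> e = cat_zero A X (cat_cod A c)" using comp_assoc[OF e(1) m C(1)] C(2) by simp
    then show "c \<cdot> m = cat_zero A I (cat_cod A c)"
      using epi_comp_zero[OF e(2,1)] comp_hom m C(1) by blast
  next
    fix V t assume t: "t \<in> Hom Y V" "t \<cdot> m = cat_zero A I V"
    then have "t \<cdot> (m \<cdot> e) = cat_zero A X V"
      using comp_assoc[OF e(1) m t(1)] comp_zero_left[OF e(1)] HomD[OF t(1)] by simp
    then show "\<exists>u \<in> Hom (cat_cod A c) V. u \<cdot> c = t" using C(4) t by blast
  qed
qed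

end

context abelian_category
begin

text \<open>
  A monomorphism is the kernel of some \<open>g\<close>; since \<open>g\<close> factors through the cokernel \<open>c\<close>, whatever
  \<open>c\<close> kills is killed by \<open>g\<close>.
\<close>

lemma mono_kernel_of_cokernel:
  assumes m: "is_mono A m" "m \<in> Hom X Y" and c: "is_cokernel A m c"
  shows "is_kernel A c m"
proof -
  note C = is_cokernelD[OF c m(2)]
  obtain g where g: "is_kernel A g m" using mono_is_kernel m by blast
  then obtain Z where gh: "g \<in> Hom Y Z"
    using HomD[OF m(2)] arr_Hom by (metis is_kernel_def)
  note G = is_kernelD[OF g gh, unfolded HomD[OF m(2)]]
  obtain w where w: "w \<in> Hom (cat_cod A c) Z" "w \<cdot> c = g" using C(4)[OF gh G(2)] by blast
  show ?thesis
  proof (rule is_kernelI[OF C(1) m(2,1) C(2)])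
    fix V t assume t: "t \<in> Hom V Y" "c \<cdot> t = cat_zero A V (cat_cod A c)"
    have "g \<cdot> t = cat_zero A V Z"
      using w comp_assoc[OF t(1) C(1) w(1)] t comp_zero_right[OF w(1)] HomD[OF t(1)] by simp
    then show "\<exists>u \<in> Hom V X. m \<cdot> u = t" using G(4)[OF t(1)] by blast
  qed
qed

lemma epi_cokernel_of_kernel:
  assumes e: "is_epi A e" "e \<in> Hom X Y" and k: "is_kernel A e k"
  shows "is_cokernel A k e"
proof -
  note K = is_kernelD[OF k e(2)]
  obtain g where g: "is_cokernel A g e" using epi_is_cokernel e by blast
  then obtain Z where gh: "g \<in> Hom Z X"
    using HomD[OF e(2)] arr_Hom by (metis is_cokernel_def)
  note G = is_cokernelD[OF g gh, unfolded HomD[OF e(2)]]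
  obtain w where w: "w \<in> Hom Z (cat_dom A k)" "k \<cdot> w = g" using K(4)[OF gh G(2)] by blast
  show ?thesis
  proof (rule is_cokernelI[OF K(1) e(2,1) K(2)])
    fix V t assume t: "t \<in> Hom X V" "t \<cdot> k = cat_zero A (cat_dom A k) V"
    have "t \<cdot> g = cat_zero A Z V"
      using w comp_assoc[OF w(1) K(1) t(1)] t comp_zero_left[OF w(1)] HomD[OF t(1)] by simp
    then show "\<exists>u \<in> Hom Y V. u \<cdot> e = t" using G(4)[OF t(1)] by blast
  qed
qed

lemma mono_epi_is_iso:
  assumes "is_mono A f" "is_epi A f"
  shows "is_iso A f"
proof -
  define X Y where "X = cat_dom A f" and "Y = cat_cod A f"
  have f: "f \<in> Hom X Y" using assms by (auto simp: is_mono_def cat_hom_def X_def Y_def)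
  note obj = HomD[OF f]
  obtain c where c: "is_cokernel A f c" using ex_cokernel obj by blast
  note C = is_cokernelD[OF c f]
  have c0: "c = cat_zero A Y (cat_cod A c)" using epi_comp_zero[OF assms(2) f C(1,2)] .
  have "c \<cdot> cat_id A Y = cat_zero A Y (cat_cod A c)" using c0 comp_id_right[OF C(1)] by simp
  then obtain u where u: "u \<in> Hom Y X" "f \<cdot> u = cat_id A Y"
    using is_kernelD(4)[OF mono_kernel_of_cokernel[OF assms(1) f c] C(1) id_hom[OF obj(2)]]
    obj by auto
  have "f \<cdot> (u \<cdot> f) = f \<cdot> cat_id A X"
    using comp_assoc[OF f u(1) f] u(2) comp_id_left[OF f] comp_id_right[OF f] by simp
  then have "u \<cdot> f = cat_id A X"
    using is_mono_cancel[OF assms(1) f] comp_hom[OF f u(1)] id_hom[OF obj(1)] by blast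
  then show ?thesis using u obj by (auto simp: is_iso_def)
qed

text \<open>
  Let \<open>e\<close> be the factor of \<open>f\<close> through \<open>m\<close>. If \<open>r\<close> kills \<open>e\<close> and \<open>n\<close> is the kernel of \<open>r\<close>, then
  \<open>f\<close> factors through the monomorphism \<open>m \<cdot> n\<close>. The cokernel of \<open>m \<cdot> n\<close> therefore kills \<open>f\<close>, so
  it factors through \<open>c\<close> and kills \<open>m\<close>. Hence \<open>m\<close> factors through \<open>m \<cdot> n\<close>, which makes \<open>n\<close> a
  split epimorphism and \<open>r\<close> zero.
\<close>

lemma image_factorization:
  assumes f: "f \<in> Hom X Y" and c: "is_cokernel A f c" and m: "is_kernel A c m"
  shows "\<exists>e \<in> Hom X (cat_dom A m). m \<cdot> e = f \<and> is_epi A e"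
proof -
  define I where "I = cat_dom A m"
  note C = is_cokernelD[OF c f]
  note M = is_kernelD[OF m C(1), folded I_def]
  obtain e where e: "e \<in> Hom X I" "m \<cdot> e = f" using M(4)[OF f C(2)] by blast
  have "is_epi A e"
  proof (rule epiI[OF e(1)])
    fix R r assume r: "r \<in> Hom I R" "r \<cdot> e = cat_zero A X R"
    obtain n where n: "is_kernel A r n" using ex_kernel HomD(3)[OF r(1)] by blast
    define N where "N = cat_dom A n"
    note Nn = is_kernelD[OF n r(1), folded N_def]
    obtain e' where e': "e' \<in> Hom X N" "n \<cdot> e' = e" using Nn(4)[OF e(1) r(2)] by blast
    have mn: "m \<cdot> n \<in> Hom N Y" using comp_hom Nn(1) M(1) by blast
    obtain h where h: "is_cokernel A (m \<cdot> n) h" using ex_cokernel HomD(3)[OF mn] by blast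
    note H = is_cokernelD[OF h mn]
    have hobj: "cat_cod A h \<in> cat_obj A" using HomD H(1) by blast
    have "f = (m \<cdot> n) \<cdot> e'" using e e' comp_assoc[OF e'(1) Nn(1) M(1)] by simp
    then have "h \<cdot> f = cat_zero A X (cat_cod A h)"
      using comp_assoc[OF e'(1) mn H(1)] H(2) comp_zero_left[OF e'(1) hobj] by simp
    then obtain h' where h': "h' \<in> Hom (cat_cod A c) (cat_cod A h)" "h' \<cdot> c = h"
      using C(4)[OF H(1)] by blast
    have "h \<cdot> m = cat_zero A I (cat_cod A h)"
      using h' comp_assoc[OF M(1) C(1) h'(1)] M(2) comp_zero_right[OF h'(1)] HomD[OF M(1)] by simp
    then obtain w where w: "w \<in> Hom I N" "(m \<cdot> n) \<cdot> w = m"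
      using is_kernelD(4)[OF mono_kernel_of_cokernel[OF is_mono_comp[OF Nn(1) M(1) Nn(3) M(3)] mn h]
        H(1) M(1)] HomD[OF mn] by auto
    have "m \<cdot> (n \<cdot> w) = m \<cdot> cat_id A I"
      using w comp_assoc[OF w(1) Nn(1) M(1)] comp_id_right[OF M(1)] by simp
    then have nw: "n \<cdot> w = cat_id A I"
      using is_mono_cancel[OF M(3,1)] comp_hom[OF w(1) Nn(1)] id_hom HomD[OF M(1)] by blast
    have "r = r \<cdot> (n \<cdot> w)" using nw comp_id_right[OF r(1)] by simp
    also have "\<dots> = cat_zero A I R"
      using comp_assoc[OF w(1) Nn(1) r(1)] Nn(2) comp_zero_left[OF w(1)] HomD[OF r(1)] by simp
    finally show "r = cat_zero A I R" .
  qed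
  then show ?thesis using e unfolding I_def by blast
qed

lemma ex_image_sequence:
  assumes f: "f \<in> Hom X Y"
  obtains I Q e m c where "e \<in> Hom X I" "is_epi A e" "m \<in> Hom I Y" "is_mono A m" "m \<cdot> e = f"
    "c \<in> Hom Y Q" "is_epi A c" "is_cokernel A f c" "is_image A f m" "short_exact A m c"
proof -
  obtain c where c: "is_cokernel A f c" using ex_cokernel HomD(3)[OF f] by blast
  note C = is_cokernelD[OF c f]
  obtain m where m: "is_kernel A c m" using ex_kernel HomD(3)[OF C(1)] by blast
  note M = is_kernelD[OF m C(1)]
  obtain e where e: "e \<in> Hom X (cat_dom A m)" "m \<cdot> e = f" "is_epi A e"
    using image_factorization[OF f c m] by blast
  have "is_cokernel A m c" using is_cokernel_precomp_epi[OF e(1,3) M(1)] e(2) c by simp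
  then show thesis
    using that[OF e(1,3) M(1,3) e(2) C(1,3) c] c m by (auto simp: is_image_def short_exact_def)
qed

text \<open>
  Epimorphisms are stable under pullback: \<open>P\<close> is the pullback, constructed as the kernel of the
  difference map \<open>d = (q, -t)\<close> from the biproduct of \<open>X\<close> and \<open>V\<close> to \<open>Q\<close>. As \<open>d\<close> is epi, it is the
  cokernel of that kernel; so if \<open>g\<close> kills the projection \<open>P \<rightarrow> V\<close>, then \<open>(0, g)\<close> factors through
  \<open>d\<close>, by a map that kills \<open>q\<close> and hence vanishes.
\<close>

lemma epi_lift:
  assumes q: "q \<in> Hom X Q" "is_epi A q" and t: "t \<in> Hom V Q"
  obtains P e u where "e \<in> Hom P V" "is_epi A e" "u \<in> Hom P X" "q \<cdot> u = t \<cdot> e"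
proof -
  obtain S i j p r where i: "i \<in> Hom X S" and j: "j \<in> Hom V S" and p: "p \<in> Hom S X"
    and r: "r \<in> Hom S V" and eqs: "p \<cdot> i = cat_id A X" "r \<cdot> j = cat_id A V"
    "r \<cdot> i = cat_zero A X V" "p \<cdot> j = cat_zero A V X"
    using ex_biproduct[OF HomD(1)[OF q(1)] HomD(1)[OF t]] by blast
  obtain n where n: "n \<in> Hom V Q" "t \<boxplus> n = cat_zero A V Q" using ex_neg t by blast
  note obj = HomD(1,2)[OF q(1)] HomD(1)[OF t]
  define d where "d = (q \<cdot> p) \<boxplus> (n \<cdot> r)"
  have qp: "q \<cdot> p \<in> Hom S Q" and nr: "n \<cdot> r \<in> Hom S Q" using comp_hom q(1) p n(1) r by blast+
  then have d: "d \<in> Hom S Q" using add_hom d_def by simp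
  have di: "d \<cdot> i = q"
  proof -
    have "d \<cdot> i = ((q \<cdot> p) \<cdot> i) \<boxplus> ((n \<cdot> r) \<cdot> i)" using d_def comp_add_left[OF i qp nr] by simp
    also have "\<dots> = (q \<cdot> cat_id A X) \<boxplus> (n \<cdot> cat_zero A X V)"
      using comp_assoc[OF i p q(1)] comp_assoc[OF i r n(1)] eqs by simp
    also have "\<dots> = q"
      using comp_id_right[OF q(1)] comp_zero_right[OF n(1)] add_zero(1)[OF q(1)] obj by simp
    finally show ?thesis .
  qed
  have dj: "d \<cdot> j = n"
  proof -
    have "d \<cdot> j = ((q \<cdot> p) \<cdot> j) \<boxplus> ((n \<cdot> r) \<cdot> j)" using d_def comp_add_left[OF j qp nr] by simp
    also have "\<dots> = (q \<cdot> cat_zero A V X) \<boxplus> (n \<cdot> cat_id A V)"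
      using comp_assoc[OF j p q(1)] comp_assoc[OF j r n(1)] eqs by simp
    also have "\<dots> = n"
      using comp_id_right[OF n(1)] comp_zero_right[OF q(1)] add_zero(2)[OF n(1)] obj by simp
    finally show ?thesis .
  qed
  have depi: "is_epi A d"
  proof (rule epiI[OF d])
    fix Z g assume g: "g \<in> Hom Q Z" "g \<cdot> d = cat_zero A S Z"
    then have "g \<cdot> q = cat_zero A X Z"
      using comp_assoc[OF i d g(1)] di comp_zero_left[OF i] HomD[OF g(1)] by simp
    then show "g = cat_zero A Q Z" using epi_comp_zero[OF q(2,1) g(1)] by simp
  qed
  obtain k where k: "is_kernel A d k" using ex_kernel HomD[OF d] by blast
  define P where "P = cat_dom A k"
  note K = is_kernelD[OF k d, folded P_def]
  have Pobj: "P \<in> cat_obj A" using HomD K(1) by blast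
  have rk: "r \<cdot> k \<in> Hom P V" and pk: "p \<cdot> k \<in> Hom P X" using comp_hom K(1) r p by blast+
  have "is_epi A (r \<cdot> k)"
  proof (rule epiI[OF rk])
    fix Z g assume g: "g \<in> Hom V Z" "g \<cdot> (r \<cdot> k) = cat_zero A P Z"
    have gr: "g \<cdot> r \<in> Hom S Z" using comp_hom r g by blast
    have "(g \<cdot> r) \<cdot> k = cat_zero A P Z" using comp_assoc[OF K(1) r g(1)] g by simp
    then obtain w where w: "w \<in> Hom Q Z" "w \<cdot> d = g \<cdot> r"
      using is_cokernelD(4)[OF epi_cokernel_of_kernel[OF depi d k] K(1) gr]
        HomD[OF d] by auto
    have Z: "Z \<in> cat_obj A" using HomD g by blast
    have "w \<cdot> q = (w \<cdot> d) \<cdot> i" using di comp_assoc[OF i d w(1)] by simp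
    also have "\<dots> = g \<cdot> cat_zero A X V" using w comp_assoc[OF i r g(1)] eqs by simp
    also have "\<dots> = cat_zero A X Z" using comp_zero_right[OF g(1)] obj by simp
    finally have "w = cat_zero A Q Z" using epi_comp_zero[OF q(2,1) w(1)] by simp
    then have "g \<cdot> r = cat_zero A S Z" using w(2) comp_zero_left[OF d Z] by simp
    then have "(g \<cdot> r) \<cdot> j = cat_zero A V Z" using comp_zero_left[OF j Z] by simp
    then show "g = cat_zero A V Z" using comp_assoc[OF j r g(1)] eqs comp_id_right[OF g(1)] by simp
  qed
  moreover have "q \<cdot> (p \<cdot> k) = t \<cdot> (r \<cdot> k)"
  proof -
    have "(q \<cdot> (p \<cdot> k)) \<boxplus> (n \<cdot> (r \<cdot> k)) = d \<cdot> k"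
      using d_def comp_add_left[OF K(1) qp nr] comp_assoc[OF K(1) p q(1)]
        comp_assoc[OF K(1) r n(1)] by simp
    also have "\<dots> = (t \<boxplus> n) \<cdot> (r \<cdot> k)" using K(2) n(2) comp_zero_left[OF rk] obj by simp
    also have "\<dots> = (t \<cdot> (r \<cdot> k)) \<boxplus> (n \<cdot> (r \<cdot> k))" using comp_add_left[OF rk t n(1)] .
    finally show ?thesis
      using add_right_cancel comp_hom[OF pk q(1)] comp_hom[OF rk t] comp_hom[OF rk n(1)] by blast
  qed
  ultimately show thesis using that[OF rk _ pk] by blast
qed

lemma hom_to_simple_epi:
  assumes S: "simple_object A S" and f: "f \<in> Hom X S" "f \<noteq> cat_zero A X S"
  shows "is_epi A f"
proof -
  obtain I Q e m c where im: "e \<in> Hom X I" "is_epi A e" "m \<in> Hom I S" "is_mono A m" "m \<cdot> e = f"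
    using ex_image_sequence[OF f(1)] by metis
  have "\<not> is_zero_object A I"
  proof
    assume "is_zero_object A I"
    then have "m = cat_zero A I S" using hom_from_zero_object im(3) by blast
    then show False using f(2) im(5) comp_zero_left[OF im(1)] HomD[OF f(1)] by simp
  qed
  then have "is_iso A m" using S im(3,4) HomD[OF im(3)] by (auto simp: simple_object_def)
  then show ?thesis using is_epi_comp[OF im(1,3,2)] is_iso_imp_epi im(5) by blast
qed

end


section \<open>Length\<close>

context abelian_category
begin

lemma short_exactD:
  assumes "short_exact A f g"
  shows "f \<in> Hom (cat_dom A f) (cat_cod A f)" "g \<in> Hom (cat_cod A f) (cat_cod A g)"
    "is_kernel A g f" "is_cokernel A f g" "is_mono A f" "is_epi A g"
proof -
  show k: "is_kernel A g f" and c: "is_cokernel A f g"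
    using assms by (auto simp: short_exact_def)
  show f: "f \<in> Hom (cat_dom A f) (cat_cod A f)" and g: "g \<in> Hom (cat_cod A f) (cat_cod A g)"
    using c by (auto simp: is_cokernel_def cat_hom_def)
  show "is_mono A f" using is_kernelD(3)[OF k g] .
  show "is_epi A g" using is_cokernelD(3)[OF c f] .
qed

lemma short_exact_zero_iff:
  assumes "short_exact A f g" "f \<in> Hom K X" "g \<in> Hom X Q"
  shows "is_zero_object A K \<longleftrightarrow> is_mono A g" "is_zero_object A Q \<longleftrightarrow> is_epi A f"
proof -
  note S = short_exactD[OF assms(1)]
  note KK = is_kernelD[OF S(3) assms(3), unfolded HomD[OF assms(2)]]
  note CC = is_cokernelD[OF S(4) assms(2), unfolded HomD[OF assms(3)]]
  show "is_zero_object A K \<longleftrightarrow> is_mono A g"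
  proof
    assume Z: "is_zero_object A K"
    show "is_mono A g"
    proof (rule monoI[OF assms(3)])
      fix V t assume t: "t \<in> Hom V X" "g \<cdot> t = cat_zero A V Q"
      obtain u where u: "u \<in> Hom V K" "f \<cdot> u = t" using KK(4)[OF t] by blast
      then have "u = cat_zero A V K" using hom_to_zero_object[OF Z] by blast
      then show "t = cat_zero A V X" using u comp_zero_right[OF assms(2)] HomD[OF t(1)] by auto
    qed
  next
    assume "is_mono A g"
    then show "is_zero_object A K"
      using mono_comp_zero[OF _ assms(3,2) KK(2)] mono_dom_zero[OF S(5) assms(2)] by blast
  qed
  show "is_zero_object A Q \<longleftrightarrow> is_epi A f"
  proof
    assume Z: "is_zero_object A Q"
    show "is_epi A f"
    proof (rule epiI[OF assms(2)])
      fix V t assume t: "t \<in> Hom X V" "t \<cdot> f = cat_zero A K V"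
      obtain u where u: "u \<in> Hom Q V" "u \<cdot> g = t" using CC(4)[OF t] by blast
      then have "u = cat_zero A Q V" using hom_from_zero_object[OF Z] by blast
      then show "t = cat_zero A X V" using u comp_zero_left[OF assms(3)] HomD[OF t(1)] by auto
    qed
  next
    assume "is_epi A f"
    then show "is_zero_object A Q"
      using epi_comp_zero[OF _ assms(2,3) CC(2)] epi_cod_zero[OF S(6) assms(3)] by blast
  qed
qed

text \<open>
  Composition series read from the top: each step replaces an object by the kernel of a map to a
  simple object. A step may be wasted on the zero map, which is harmless because only the least
  length is used below.
\<close>

inductive has_length :: "nat \<Rightarrow> 'a \<Rightarrow> bool" where
  zero: "is_zero_object A X \<Longrightarrow> has_length 0 X"
| step: "\<lbrakk>s \<in> Hom X S; simple_object A S; is_kernel A s f; has_length n (cat_dom A f)\<rbrakk>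
    \<Longrightarrow> has_length (Suc n) X"

lemma finite_length_has_length:
  assumes "finite_length A X"
  shows "\<exists>n. has_length n X"
proof -
  obtain n :: nat and Y f where Y: "is_zero_object A (Y 0)" "Y n = X" and
    f: "\<And>i. i < n \<Longrightarrow> f i \<in> Hom (Y i) (Y (Suc i)) \<and>
        (\<exists>q. short_exact A (f i) q \<and> simple_object A (cat_cod A q))"
    using assms unfolding finite_length_def by blast
  have "i \<le> n \<Longrightarrow> has_length i (Y i)" for i
  proof (induction i)
    case 0
    then show ?case using Y zero by simp
  next
    case (Suc i)
    then obtain q where fi: "f i \<in> Hom (Y i) (Y (Suc i))"
      and q: "short_exact A (f i) q" "simple_object A (cat_cod A q)" using f[of i] by auto
    have "q \<in> Hom (Y (Suc i)) (cat_cod A q)" using short_exactD(2)[OF q(1)] HomD[OF fi] by simp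
    then show ?case using step q short_exactD(3)[OF q(1)] Suc HomD[OF fi] by auto
  qed
  then show ?thesis using Y(2) by blast
qed

text \<open>
  Induct on the filtration of \<open>X\<close>, whose top factor is \<open>s: X \<rightarrow> S\<close> with kernel \<open>f: Y \<rightarrow> X\<close>.
  Simplicity leaves two cases for \<open>s \<cdot> k: K \<rightarrow> S\<close>. If it vanishes, then \<open>K\<close> lies in \<open>Y\<close> and \<open>S\<close>
  is the top factor of \<open>Q\<close>: the kernel of \<open>Q \<rightarrow> S\<close> is the quotient of \<open>Y\<close> by \<open>K\<close>. If it is
  epi, then \<open>S\<close> is the top factor of \<open>K\<close>, and \<open>Q\<close> is already a quotient of \<open>Y\<close>, with kernel the
  kernel of \<open>s \<cdot> k\<close>.
\<close>

lemma short_exact_has_length: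
  "\<lbrakk>has_length n X; k \<in> Hom K X; q \<in> Hom X Q; short_exact A k q\<rbrakk>
    \<Longrightarrow> \<exists>a b. a + b \<le> n \<and> has_length a K \<and> has_length b Q"
proof (induction arbitrary: k K q Q rule: has_length.induct)
  case (zero X)
  note S = short_exactD[OF zero(4)]
  have "is_zero_object A K"
    using mono_dom_zero[OF S(5) zero(2) hom_to_zero_object[OF zero(1,2)]] .
  moreover have "is_zero_object A Q"
    using epi_cod_zero[OF S(6) zero(3) hom_from_zero_object[OF zero(1,3)]] .
  ultimately show ?case using has_length.zero by (intro exI[of _ 0]) simp
next
  case (step s X S f n)
  note k = step(6) and q = step(7)
  note E = short_exactD[OF step(8)]
  note KQ = is_kernelD[OF E(3) q, unfolded HomD[OF k]]
  note CQ = is_cokernelD[OF E(4) k, unfolded HomD[OF q]]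
  define Y where "Y = cat_dom A f"
  note F = is_kernelD[OF step(3,1), folded Y_def]
  have sk: "s \<cdot> k \<in> Hom K S" using comp_hom k step(1) by blast
  have qf: "q \<cdot> f \<in> Hom Y Q" using comp_hom q F(1) by blast
  have Sobj: "S \<in> cat_obj A" and Yobj: "Y \<in> cat_obj A" using HomD sk qf by blast+
  show ?case
  proof (cases "s \<cdot> k = cat_zero A K S")
    case True
    obtain k' where k': "k' \<in> Hom K Y" "f \<cdot> k' = k" using F(4)[OF k True] by blast
    obtain s' where s': "s' \<in> Hom Q S" "s' \<cdot> q = s" using CQ(4)[OF step(1) True] by blast
    obtain m where m: "is_kernel A s' m" using ex_kernel HomD[OF s'(1)] by blast
    define M where "M = cat_dom A m"
    note M = is_kernelD[OF m s'(1), folded M_def]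
    have "s' \<cdot> (q \<cdot> f) = cat_zero A Y S" using comp_assoc[OF F(1) q s'(1)] s'(2) F(2) by simp
    then obtain r where r: "r \<in> Hom Y M" "m \<cdot> r = q \<cdot> f" using M(4)[OF qf] by blast
    have "is_mono A k'" using is_mono_right_factor[OF k'(1) F(1)] k'(2) E(5) by simp
    moreover have "is_kernel A r k'"
    proof (rule is_kernelI[OF r(1) k'(1) calculation])
      have "m \<cdot> (r \<cdot> k') = cat_zero A K Q"
        using comp_assoc[OF k'(1) r(1) M(1)] r(2) comp_assoc[OF k'(1) F(1) q] k'(2) KQ(2) by simp
      then show "r \<cdot> k' = cat_zero A K M"
        using mono_comp_zero[OF M(3,1)] comp_hom[OF k'(1) r(1)] by blast
    next
      fix V t assume t: "t \<in> Hom V Y" "r \<cdot> t = cat_zero A V M"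
      have ft: "f \<cdot> t \<in> Hom V X" using comp_hom[OF t(1) F(1)] .
      have "q \<cdot> (f \<cdot> t) = m \<cdot> (r \<cdot> t)"
        using comp_assoc[OF t(1) r(1) M(1)] r(2) comp_assoc[OF t(1) F(1) q] by simp
      also have "\<dots> = cat_zero A V Q" using t(2) comp_zero_right[OF M(1)] HomD[OF t(1)] by simp
      finally obtain u where u: "u \<in> Hom V K" "k \<cdot> u = f \<cdot> t" using KQ(4)[OF ft] by blast
      have "f \<cdot> (k' \<cdot> u) = f \<cdot> t" using u(2) k'(2) comp_assoc[OF u(1) k'(1) F(1)] by simp
      then show "\<exists>u \<in> Hom V K. k' \<cdot> u = t"
        using is_mono_cancel[OF F(3,1) comp_hom[OF u(1) k'(1)] t(1)] u(1) by blast
    qed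
    moreover have "is_epi A r"
    proof (rule epiI[OF r(1)])
      fix Z g assume g: "g \<in> Hom M Z" "g \<cdot> r = cat_zero A Y Z"
      have Z: "Z \<in> cat_obj A" using HomD g by blast
      (* Lift M \<rightarrow> Q along q: the lift lands in Y because s kills it. *)
      obtain P e u where P: "e \<in> Hom P M" "is_epi A e" "u \<in> Hom P X" "q \<cdot> u = m \<cdot> e"
        using epi_lift[OF q E(6) M(1)] .
      have "s \<cdot> u = s' \<cdot> (m \<cdot> e)" using s'(2) comp_assoc[OF P(3) q s'(1)] P(4) by simp
      also have "\<dots> = cat_zero A P S"
        using comp_assoc[OF P(1) M(1) s'(1)] M(2) comp_zero_left[OF P(1)] Sobj by simp
      finally obtain v where v: "v \<in> Hom P Y" "f \<cdot> v = u" using F(4)[OF P(3)] by blast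
      have "m \<cdot> (r \<cdot> v) = m \<cdot> e"
        using comp_assoc[OF v(1) r(1) M(1)] r(2) comp_assoc[OF v(1) F(1) q] v(2) P(4) by simp
      then have "e = r \<cdot> v"
        using is_mono_cancel[OF M(3,1) comp_hom[OF v(1) r(1)] P(1)] by simp
      then have "g \<cdot> e = cat_zero A P Z"
        using comp_assoc[OF v(1) r(1) g(1)] g(2) comp_zero_left[OF v(1) Z] by simp
      then show "g = cat_zero A M Z" using epi_comp_zero[OF P(2,1) g(1)] by simp
    qed
    ultimately have "short_exact A k' r"
      using epi_cokernel_of_kernel[OF _ r(1)] by (auto simp: short_exact_def)
    then obtain a b where ab: "a + b \<le> n" "has_length a K" "has_length b M"
      using step.IH[folded Y_def, OF k'(1) r(1)] by blast
    then have "has_length (Suc b) Q"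
      using has_length.step[OF s'(1) step(2) m] by (simp add: M_def)
    then show ?thesis using ab by (intro exI[of _ a] exI[of _ "Suc b"]) simp
  next
    case False
    have epi: "is_epi A (s \<cdot> k)" using hom_to_simple_epi[OF step(2) sk False] .
    obtain k' where k': "is_kernel A (s \<cdot> k) k'" using ex_kernel HomD[OF sk] by blast
    define K' where "K' = cat_dom A k'"
    note K' = is_kernelD[OF k' sk, folded K'_def]
    have kk: "k \<cdot> k' \<in> Hom K' X" using comp_hom K'(1) k by blast
    have "s \<cdot> (k \<cdot> k') = cat_zero A K' S" using comp_assoc[OF K'(1) k step(1)] K'(2) by simp
    then obtain l where l: "l \<in> Hom K' Y" "f \<cdot> l = k \<cdot> k'" using F(4)[OF kk] by blast
    have lm: "is_mono A l"
      using is_mono_right_factor[OF l(1) F(1)] l(2) is_mono_comp[OF K'(1) k K'(3) E(5)] by simp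
    have "is_kernel A (q \<cdot> f) l"
    proof (rule is_kernelI[OF qf l(1) lm])
      show "(q \<cdot> f) \<cdot> l = cat_zero A K' Q"
        using comp_assoc[OF l(1) F(1) q] l(2) comp_assoc[OF K'(1) k q] KQ(2)
          comp_zero_left[OF K'(1)] HomD[OF q] by simp
    next
      fix V t assume t: "t \<in> Hom V Y" "(q \<cdot> f) \<cdot> t = cat_zero A V Q"
      have ft: "f \<cdot> t \<in> Hom V X" using comp_hom[OF t(1) F(1)] .
      have "q \<cdot> (f \<cdot> t) = cat_zero A V Q" using t comp_assoc[OF t(1) F(1) q] by simp
      then obtain u where u: "u \<in> Hom V K" "k \<cdot> u = f \<cdot> t" using KQ(4)[OF ft] by blast
      have "(s \<cdot> k) \<cdot> u = s \<cdot> (f \<cdot> t)" using comp_assoc[OF u(1) k step(1)] u(2) by simp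
      also have "\<dots> = cat_zero A V S"
        using comp_assoc[OF t(1) F(1) step(1)] F(2) comp_zero_left[OF t(1) Sobj] by simp
      finally obtain v where v: "v \<in> Hom V K'" "k' \<cdot> v = u" using K'(4)[OF u(1)] by blast
      have "f \<cdot> (l \<cdot> v) = f \<cdot> t"
        using comp_assoc[OF v(1) l(1) F(1)] l(2) comp_assoc[OF v(1) K'(1) k] v(2) u(2) by simp
      then show "\<exists>u \<in> Hom V K'. l \<cdot> u = t"
        using is_mono_cancel[OF F(3,1) comp_hom[OF v(1) l(1)] t(1)] v(1) by blast
    qed
    moreover have "is_epi A (q \<cdot> f)"
    proof (rule epiI[OF qf])
      fix Z g assume g: "g \<in> Hom Q Z" "g \<cdot> (q \<cdot> f) = cat_zero A Y Z"
      have Z: "Z \<in> cat_obj A" using HomD g by blast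
      have gq: "g \<cdot> q \<in> Hom X Z" using comp_hom q g(1) by blast
      have "(g \<cdot> q) \<cdot> f = cat_zero A Y Z" using g comp_assoc[OF F(1) q g(1)] by simp
      (* s is epi, hence the cokernel of f, so that g \<cdot> q factors through s. *)
      moreover have "is_epi A s"
        using hom_to_simple_epi[OF step(2,1)] comp_zero_left[OF k Sobj] False by blast
      ultimately obtain w where w: "w \<in> Hom S Z" "w \<cdot> s = g \<cdot> q"
        using is_cokernelD(4)[OF epi_cokernel_of_kernel[OF _ step(1,3)] F(1) gq] HomD[OF step(1)]
        by auto
      have "w \<cdot> (s \<cdot> k) = g \<cdot> (q \<cdot> k)"
        using comp_assoc[OF k step(1) w(1)] w(2) comp_assoc[OF k q g(1)] by simp
      also have "\<dots> = cat_zero A K Z"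
        using KQ(2) comp_zero_right[OF g(1)] HomD[OF k] by simp
      finally have "w = cat_zero A S Z" using epi_comp_zero[OF epi sk w(1)] by simp
      then have "g \<cdot> q = cat_zero A X Z" using w(2) comp_zero_left[OF step(1) Z] by simp
      then show "g = cat_zero A Q Z" using epi_comp_zero[OF E(6) q g(1)] by simp
    qed
    ultimately have "short_exact A l (q \<cdot> f)"
      using epi_cokernel_of_kernel[OF _ qf] by (auto simp: short_exact_def)
    then obtain a b where ab: "a + b \<le> n" "has_length a K'" "has_length b Q"
      using step.IH[folded Y_def, OF l(1) qf] by blast
    then have "has_length (Suc a) K"
      using has_length.step[OF sk step(2) k'] by (simp add: K'_def)
    then show ?thesis using ab by (intro exI[of _ "Suc a"] exI[of _ b]) simp
  qed
qed

definition len :: "'a \<Rightarrow> nat" where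
  "len X = (LEAST n. has_length n X)"

end

context abelian_length_category
begin

lemma has_length_len: "X \<in> cat_obj A \<Longrightarrow> has_length (len X) X"
  unfolding len_def using finite_length_has_length[OF finite_length] LeastI_ex by metis

lemma len_eq_0_iff:
  assumes "X \<in> cat_obj A"
  shows "len X = 0 \<longleftrightarrow> is_zero_object A X"
proof
  assume "len X = 0"
  then have "has_length 0 X" using has_length_len[OF assms] by simp
  then show "is_zero_object A X" by cases
next
  assume "is_zero_object A X"
  then show "len X = 0" unfolding len_def using has_length.zero by simp
qed

lemma short_exact_len:
  assumes "short_exact A k q" "k \<in> Hom K X" "q \<in> Hom X Q"
  shows "len K + len Q \<le> len X"
proof -
  obtain a b where "a + b \<le> len X" "has_length a K" "has_length b Q"
    using short_exact_has_length[OF has_length_len assms(2,3,1)] HomD assms(2) by blast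
  moreover have "len K \<le> a" "len Q \<le> b" unfolding len_def using calculation by (simp_all add: Least_le)
  ultimately show ?thesis by linarith
qed

lemma epi_iso_or_len_less:
  assumes "is_epi A e" "e \<in> Hom X Y"
  shows "is_iso A e \<or> len Y < len X"
proof -
  obtain k where k: "is_kernel A e k" using ex_kernel HomD[OF assms(2)] by blast
  note K = is_kernelD[OF k assms(2)]
  have se: "short_exact A k e"
    using k epi_cokernel_of_kernel[OF assms k] by (simp add: short_exact_def)
  have "is_mono A e \<or> len (cat_dom A k) \<noteq> 0"
    using short_exact_zero_iff(1)[OF se K(1) assms(2)] len_eq_0_iff HomD[OF K(1)] by blast
  then show ?thesis
    using short_exact_len[OF se K(1) assms(2)] mono_epi_is_iso assms(1) by force
qed

lemma mono_iso_or_len_less: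
  assumes "is_mono A m" "m \<in> Hom X Y"
  shows "is_iso A m \<or> len X < len Y"
proof -
  obtain c where c: "is_cokernel A m c" using ex_cokernel HomD[OF assms(2)] by blast
  note C = is_cokernelD[OF c assms(2)]
  have se: "short_exact A m c"
    using c mono_kernel_of_cokernel[OF assms c] by (simp add: short_exact_def)
  have "is_epi A m \<or> len (cat_cod A c) \<noteq> 0"
    using short_exact_zero_iff(2)[OF se assms(2) C(1)] len_eq_0_iff HomD[OF C(1)] by blast
  then show ?thesis
    using short_exact_len[OF se assms(2) C(1)] mono_epi_is_iso assms(1) by force
qed

end


section \<open>Torsion classes in a wide subcategory\<close>

text \<open>
  Torsion classes are defined inside the category \<open>W\<close>, whereas wide and ICE-closed subcategories
  refer to exact sequences of \<open>A\<close>. Exact sequences and epimorphisms of \<open>A\<close> between objects of \<open>W\<close>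
  restrict to \<open>W\<close>, and this one direction suffices: the torsion classes constructed below are
  verified with the universal properties of \<open>W\<close> itself.
\<close>

locale wide_in_abelian_category = abelian_category +
  fixes W
  assumes wide: "wide_subcategory A W"
begin

lemma wide_obj: "X \<in> W \<Longrightarrow> X \<in> cat_obj A"
  using wide by (auto simp: wide_subcategory_def subcategory_def)

lemma full_subcat_Hom: "f \<in> cat_hom (full_subcat A W) X Y \<longleftrightarrow> f \<in> Hom X Y \<and> X \<in> W \<and> Y \<in> W"
  by (auto simp: full_subcat_def cat_hom_def)

lemma full_subcat_simps:
  "cat_obj (full_subcat A W) = W" "cat_dom (full_subcat A W) = cat_dom A"
  "cat_cod (full_subcat A W) = cat_cod A" "cat_comp (full_subcat A W) = cat_comp A"
  "cat_zero (full_subcat A W) = cat_zero A" "cat_id (full_subcat A W) = cat_id A"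
  "f \<in> cat_arr (full_subcat A W) \<longleftrightarrow> f \<in> cat_arr A \<and> cat_dom A f \<in> W \<and> cat_cod A f \<in> W"
  by (auto simp: full_subcat_def)

lemma is_epi_full_subcat:
  assumes "is_epi A e" "e \<in> Hom X Y" "X \<in> W" "Y \<in> W"
  shows "is_epi (full_subcat A W) e"
  using assms HomD[OF assms(2)] unfolding is_epi_def by (auto simp: full_subcat_simps full_subcat_Hom)

lemma short_exact_full_subcat:
  assumes "short_exact A f g" "f \<in> Hom X Y" "g \<in> Hom Y Z" "X \<in> W" "Y \<in> W" "Z \<in> W"
  shows "short_exact (full_subcat A W) f g"
  using assms HomD[OF assms(2)] HomD[OF assms(3)]
  by (simp add: short_exact_def is_kernel_def is_cokernel_def full_subcat_simps full_subcat_Hom)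

lemma wide_zero:
  assumes "is_zero_object A Z"
  shows "Z \<in> W"
proof -
  obtain Z' where Z': "Z' \<in> W" "is_zero_object A Z'"
    using wide by (auto simp: wide_subcategory_def subcategory_def)
  have obj: "Z \<in> cat_obj A" "Z' \<in> cat_obj A" using assms Z' by (auto simp: is_zero_object_def)
  have z: "cat_zero A Z' Z \<in> Hom Z' Z" using zero_hom obj by blast
  have "is_mono A (cat_zero A Z' Z)"
    using monoI[OF z] hom_to_zero_object[OF Z'(2)] by blast
  then have "is_iso A (cat_zero A Z' Z)"
    using mono_epi_is_iso epi_to_zero_object[OF assms z] by blast
  then show ?thesis
    using wide Z'(1) HomD[OF z] unfolding wide_subcategory_def subcategory_def by metis
qed

lemma ex_image_sequence_wide:
  assumes "f \<in> Hom X Y" "X \<in> W" "Y \<in> W"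
  obtains I Q e m c where "e \<in> Hom X I" "is_epi A e" "m \<in> Hom I Y" "is_mono A m" "m \<cdot> e = f"
    "c \<in> Hom Y Q" "is_epi A c" "is_cokernel A f c" "is_image A f m" "short_exact A m c"
    "I \<in> W" "Q \<in> W"
proof -
  obtain I Q e m c where s: "e \<in> Hom X I" "is_epi A e" "m \<in> Hom I Y" "is_mono A m" "m \<cdot> e = f"
    "c \<in> Hom Y Q" "is_epi A c" "is_cokernel A f c" "is_image A f m" "short_exact A m c"
    using ex_image_sequence[OF assms(1)] .
  have Q: "Q \<in> W"
    using wide s(8) HomD[OF assms(1)] HomD[OF s(6)] assms(2,3)
    unfolding wide_subcategory_def cokernel_closed_def by metis
  have "I \<in> W"
    using wide short_exactD(3)[OF s(10)] HomD[OF s(3)] HomD[OF s(6)] assms(3) Q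
    unfolding wide_subcategory_def kernel_closed_def by metis
  then show thesis using that[OF s] Q by blast
qed

lemma tors_subset: "T \<in> tors (full_subcat A W) \<Longrightarrow> T \<subseteq> W"
  by (auto simp: tors_def torsion_class_def subcategory_def full_subcat_simps)

lemma tors_quotient:
  assumes "T \<in> tors (full_subcat A W)" "is_epi A e" "e \<in> Hom X Y" "X \<in> T" "Y \<in> W"
  shows "Y \<in> T"
  using assms is_epi_full_subcat[OF assms(2,3)] tors_subset[OF assms(1)] HomD[OF assms(3)]
  by (auto simp: tors_def torsion_class_def quotient_closed_def full_subcat_simps)

lemma tors_extension:
  assumes T: "T \<in> tors (full_subcat A W)"
    and se: "short_exact A f g" "f \<in> Hom X Y" "g \<in> Hom Y Z" and XZ: "X \<in> T" "Z \<in> T"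
  shows "Y \<in> T"
proof -
  have W: "X \<in> W" "Z \<in> W" using XZ tors_subset[OF T] by auto
  then have "Y \<in> W"
    using wide se HomD[OF se(2)] HomD[OF se(3)]
    unfolding wide_subcategory_def extension_closed_def by metis
  then have "short_exact (full_subcat A W) f g" using short_exact_full_subcat[OF se] W by blast
  then show ?thesis
    using T HomD[OF se(2)] HomD[OF se(3)] XZ
    by (auto simp: tors_def torsion_class_def extension_closed_def full_subcat_simps)
qed

lemma tors_zero:
  assumes T: "T \<in> tors (full_subcat A W)" and Z: "is_zero_object A Z"
  shows "Z \<in> T"
proof -
  obtain Z' where Z': "Z' \<in> T"
    using T by (auto simp: tors_def torsion_class_def subcategory_def)
  have z: "cat_zero A Z' Z \<in> Hom Z' Z"
    using zero_hom wide_obj tors_subset[OF T] Z' Z by (auto simp: is_zero_object_def)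
  show ?thesis using tors_quotient[OF T epi_to_zero_object[OF Z z] z Z' wide_zero[OF Z]] .
qed

text \<open>
  Cokernels and images of maps in \<open>W\<close> are formed in \<open>A\<close>, and they are quotients of the target
  and of the source respectively.
\<close>

lemma tors_subset_ice: "tors (full_subcat A W) \<subseteq> ice A"
proof
  fix T assume T: "T \<in> tors (full_subcat A W)"
  note TW = tors_subset[OF T]
  have "subcategory A T"
    unfolding subcategory_def
  proof (intro conjI allI impI)
    show "T \<subseteq> cat_obj A" using TW wide_obj by blast
    show "\<exists>Z \<in> T. is_zero_object A Z" using ex_zero_object tors_zero[OF T] by blast
    fix f assume f: "is_iso A f \<and> cat_dom A f \<in> T"
    then have "cat_cod A f \<in> W"
      using wide TW unfolding wide_subcategory_def subcategory_def by blast
    then show "cat_cod A f \<in> T"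
      using tors_quotient[OF T is_iso_imp_epi arr_Hom] f by (auto simp: is_iso_def)
  qed
  moreover have "image_closed A T"
    unfolding image_closed_def
  proof (intro allI impI, elim conjE)
    fix f i assume i: "is_image A f i" and f: "cat_dom A f \<in> T" "cat_cod A f \<in> T"
    obtain c where c: "is_cokernel A f c" "is_kernel A c i" using i by (auto simp: is_image_def)
    have fh: "f \<in> Hom (cat_dom A f) (cat_cod A f)"
      using c by (auto simp: is_cokernel_def cat_hom_def)
    obtain e where e: "e \<in> Hom (cat_dom A f) (cat_dom A i)" "is_epi A e"
      using image_factorization[OF fh c] by blast
    have "cat_cod A c \<in> W"
      using wide c(1) f TW unfolding wide_subcategory_def cokernel_closed_def by blast
    then have "cat_dom A i \<in> W"
      using wide c f TW unfolding wide_subcategory_def kernel_closed_def is_cokernel_def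
      by (metis subsetD)
    then show "cat_dom A i \<in> T" using tors_quotient[OF T e(2,1) f(1)] by blast
  qed
  moreover have "cokernel_closed A T"
    unfolding cokernel_closed_def
  proof (intro allI impI, elim conjE)
    fix f c assume c: "is_cokernel A f c" and f: "cat_dom A f \<in> T" "cat_cod A f \<in> T"
    have fh: "f \<in> Hom (cat_dom A f) (cat_cod A f)"
      using c by (auto simp: is_cokernel_def cat_hom_def)
    have "cat_cod A c \<in> W"
      using wide c f TW unfolding wide_subcategory_def cokernel_closed_def by blast
    then show "cat_cod A c \<in> T"
      using tors_quotient[OF T is_cokernelD(3,1)[OF c fh] f(2)] by blast
  qed
  moreover have "extension_closed A T"
    unfolding extension_closed_def
    using tors_extension[OF T _ short_exactD(1,2)] by blast
  ultimately show "T \<in> ice A" by (simp add: ice_def ICE_closed_def)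
qed

definition left_perp where
  "left_perp T F = {X \<in> T. \<forall>Y \<in> F. \<forall>h \<in> Hom X Y. h = cat_zero A X Y}"

text \<open>
  A map to \<open>F\<close> that kills the subobject of an extension factors through the quotient, and a nonzero
  map out of a quotient stays nonzero when composed with the epimorphism onto it.
\<close>

lemma left_perp_tors:
  assumes T: "T \<in> tors (full_subcat A W)" and F: "F \<subseteq> W"
  shows "left_perp T F \<in> tors (full_subcat A W)"
proof -
  let ?K = "full_subcat A W"
  note tc = T[unfolded tors_def torsion_class_def mem_Collect_eq]
  have quot: "Y \<in> left_perp T F"
    if e: "e \<in> Hom X Y" "\<And>V g h. \<lbrakk>V \<in> W; g \<in> Hom Y V; h \<in> Hom Y V; g \<cdot> e = h \<cdot> e\<rbrakk> \<Longrightarrow> g = h"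
      and X: "X \<in> left_perp T F" and Y: "Y \<in> T" for X Y e
  proof -
    have "h = cat_zero A Y V" if V: "V \<in> F" and h: "h \<in> Hom Y V" for V h
    proof -
      have "h \<cdot> e = cat_zero A X V" using X V comp_hom[OF e(1) h] by (auto simp: left_perp_def)
      also have "\<dots> = cat_zero A Y V \<cdot> e" using comp_zero_left[OF e(1)] HomD[OF h] by simp
      finally show ?thesis using e(2) h V F zero_hom HomD[OF h] by blast
    qed
    then show ?thesis using Y by (auto simp: left_perp_def)
  qed
  have epi: "Y \<in> left_perp T F"
    if e: "is_epi ?K e" "e \<in> Hom X Y" and X: "X \<in> left_perp T F" and Y: "Y \<in> T" for X Y e
  proof (rule quot[OF e(2) _ X Y])
    fix V g h assume "V \<in> W" "g \<in> Hom Y V" "h \<in> Hom Y V" "g \<cdot> e = h \<cdot> e"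
    moreover have "Y \<in> W" using Y tors_subset[OF T] by blast
    ultimately show "g = h"
      using e HomD[OF e(2)] by (auto simp: is_epi_def full_subcat_simps full_subcat_Hom)
  qed
  have "subcategory ?K (left_perp T F)"
    unfolding subcategory_def
  proof (intro conjI allI impI)
    show "left_perp T F \<subseteq> cat_obj ?K"
      using tors_subset[OF T] by (auto simp: left_perp_def full_subcat_simps)
    obtain Z where Z: "Z \<in> T" "is_zero_object ?K Z" using tc by (auto simp: subcategory_def)
    have "h = cat_zero A Z V" if "V \<in> F" "h \<in> Hom Z V" for V h
    proof -
      have "V \<in> W" "Z \<in> W" using that F Z tors_subset[OF T] by auto
      moreover have "cat_zero A Z V \<in> Hom Z V" using zero_hom HomD[OF that(2)] by blast
      ultimately show ?thesis
        using Z that unfolding is_zero_object_def by (auto simp: full_subcat_simps full_subcat_Hom)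
    qed
    then show "\<exists>Z \<in> left_perp T F. is_zero_object ?K Z" using Z by (auto simp: left_perp_def)
    fix f assume f: "is_iso ?K f \<and> cat_dom ?K f \<in> left_perp T F"
    have "is_iso A f"
      using f by (auto simp: is_iso_def full_subcat_simps full_subcat_Hom)
    then have fA: "f \<in> Hom (cat_dom A f) (cat_cod A f)" "is_epi A f"
      using is_iso_imp_epi by (auto simp: is_iso_def cat_hom_def)
    have "cat_cod A f \<in> T"
      using f tc unfolding subcategory_def left_perp_def by (auto simp: full_subcat_simps)
    then show "cat_cod ?K f \<in> left_perp T F"
      using quot[OF fA(1)] is_epi_cancel[OF fA(2,1)] f by (auto simp: full_subcat_simps)
  qed
  moreover have "extension_closed ?K (left_perp T F)"
    unfolding extension_closed_def
  proof (intro allI impI, elim conjE)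
    fix f g assume se: "short_exact ?K f g" and ends: "cat_dom ?K f \<in> left_perp T F"
      "cat_cod ?K g \<in> left_perp T F"
    define X Y Z where "X = cat_dom A f" and "Y = cat_cod A f" and "Z = cat_cod A g"
    have Y: "Y \<in> T"
      using se ends tc unfolding extension_closed_def left_perp_def Y_def
      by (auto simp: full_subcat_simps)
    have c: "is_cokernel ?K f g" using se by (simp add: short_exact_def)
    have f: "f \<in> Hom X Y" and g: "g \<in> Hom Y Z"
      using c by (auto simp: is_cokernel_def full_subcat_simps cat_hom_def X_def Y_def Z_def)
    have XZ: "X \<in> left_perp T F" "Z \<in> left_perp T F"
      using ends by (auto simp: X_def Z_def full_subcat_simps)
    have "h = cat_zero A Y V" if V: "V \<in> F" and h: "h \<in> Hom Y V" for V h
    proof -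
      have "h \<cdot> f = cat_zero A X V" using XZ V comp_hom[OF f h] by (auto simp: left_perp_def)
      moreover have "V \<in> W" "Y \<in> W" using V F Y tors_subset[OF T] by auto
      ultimately have "\<exists>!u. u \<in> cat_hom ?K Z V \<and> u \<cdot> g = h"
        using c h full_subcat_Hom[of h Y V]
        unfolding is_cokernel_def full_subcat_simps X_def Y_def Z_def by blast
      then obtain u where u: "u \<in> Hom Z V" "u \<cdot> g = h" by (auto simp: full_subcat_Hom)
      then have "u = cat_zero A Z V" using XZ V by (auto simp: left_perp_def)
      then show ?thesis using u comp_zero_left[OF g] HomD[OF h] by auto
    qed
    then show "cat_cod ?K f \<in> left_perp T F"
      using Y by (auto simp: left_perp_def full_subcat_simps Y_def)
  qed
  moreover have "quotient_closed ?K (left_perp T F)"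
    unfolding quotient_closed_def
  proof (intro allI impI, elim conjE)
    fix e assume e: "is_epi ?K e" "cat_dom ?K e \<in> left_perp T F"
    then have "cat_cod ?K e \<in> T"
      using tc by (auto simp: quotient_closed_def left_perp_def full_subcat_simps)
    moreover have "e \<in> Hom (cat_dom A e) (cat_cod A e)"
      using e by (auto simp: is_epi_def full_subcat_simps cat_hom_def)
    ultimately show "cat_cod ?K e \<in> left_perp T F" using epi[OF e(1)] e(2) by (simp add: full_subcat_simps)
  qed
  ultimately show ?thesis by (simp add: tors_def torsion_class_def)
qed

end


section \<open>Covers of torsion classes\<close>

text \<open>
  The shortest object \<open>B\<close> of \<open>T\<close> outside \<open>U\<close> is fixed together with the cover because both
  steps of the argument, getting \<open>B\<close> into \<open>C\<close> and then generating \<open>T\<close> from \<open>U\<close> and \<open>B\<close>, have to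
  speak of the same object.
\<close>

locale torsion_class_cover = abelian_length_category + wide_in_abelian_category +
  fixes T U B
  assumes T: "T \<in> tors (full_subcat A W)" and U: "U \<in> tors (full_subcat A W)"
    and UT: "U \<subseteq> T"
    and cover: "\<And>R. \<lbrakk>R \<in> tors (full_subcat A W); U \<subseteq> R; R \<subseteq> T\<rbrakk> \<Longrightarrow> R = U \<or> R = T"
    and B: "B \<in> T" "B \<notin> U" and B_min: "\<And>Y. \<lbrakk>Y \<in> T; Y \<notin> U\<rbrakk> \<Longrightarrow> len B \<le> len Y"
begin

lemma T_sub_W: "X \<in> T \<Longrightarrow> X \<in> W"
  using tors_subset[OF T] by blast

lemma U_sub_W: "X \<in> U \<Longrightarrow> X \<in> W"
  using tors_subset[OF U] by blast

lemma quotient_of_B: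
  assumes "is_epi A e" "e \<in> Hom B I" "I \<in> W"
  shows "is_iso A e \<or> I \<in> U"
  using epi_iso_or_len_less[OF assms(1,2)] tors_quotient[OF T assms(1,2) B(1) assms(3)] B_min
  by fastforce

text \<open>
  A nonzero map would exhibit \<open>B\<close> as an extension of a shorter quotient, which lies in \<open>U\<close>, by its
  image, which also lies in \<open>U\<close>.
\<close>

lemma hom_U_B:
  assumes "V \<in> U" and h: "h \<in> Hom V B"
  shows "h = cat_zero A V B"
proof (rule ccontr)
  assume nz: "h \<noteq> cat_zero A V B"
  obtain I Q e m c where s: "e \<in> Hom V I" "is_epi A e" "m \<in> Hom I B" "m \<cdot> e = h"
    "c \<in> Hom B Q" "is_epi A c" "is_cokernel A h c" "short_exact A m c" "I \<in> W" "Q \<in> W"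
    using ex_image_sequence_wide[OF h U_sub_W[OF assms(1)] T_sub_W[OF B(1)]] by metis
  have "I \<in> U" using tors_quotient[OF U s(2,1) assms(1) s(9)] .
  have "\<not> is_iso A c"
    using mono_comp_zero[OF is_iso_imp_mono s(5) h] is_cokernelD(2)[OF s(7) h] nz
      HomD[OF s(5)] by metis
  then have "Q \<in> U" using quotient_of_B[OF s(6,5,10)] by blast
  then show False using tors_extension[OF U s(8,3,5) \<open>I \<in> U\<close>] B(2) by blast
qed

lemma B_nonzero: "\<not> is_zero_object A B"
  using tors_zero[OF U] B(2) by blast

lemma id_nonzero: "\<lbrakk>X \<in> cat_obj A; \<not> is_zero_object A X\<rbrakk> \<Longrightarrow> cat_id A X \<noteq> cat_zero A X X"
  using is_zero_objectI by blast

text \<open>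
  The objects of \<open>T\<close> without nonzero maps to \<open>B\<close> form a torsion class between \<open>U\<close> and \<open>T\<close> that
  misses \<open>B\<close>, so this class is \<open>U\<close> and \<open>X\<close> has a nonzero map to \<open>B\<close>. Its image lies in \<open>T\<close> but,
  being a nonzero subobject of \<open>B\<close>, not in \<open>U\<close>; by minimality of \<open>B\<close> it is all of \<open>B\<close>.
\<close>

lemma ex_epi_to_B:
  assumes X: "X \<in> T" "X \<notin> U"
  obtains \<phi> where "\<phi> \<in> Hom X B" "is_epi A \<phi>"
proof -
  have "left_perp T {B} \<in> tors (full_subcat A W)"
    using left_perp_tors[OF T] T_sub_W[OF B(1)] by simp
  moreover have "U \<subseteq> left_perp T {B}" using UT hom_U_B by (auto simp: left_perp_def)
  moreover have "left_perp T {B} \<subseteq> T" by (auto simp: left_perp_def)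
  moreover have "B \<notin> left_perp T {B}"
    using id_nonzero[OF _ B_nonzero] id_hom wide_obj T_sub_W B(1) by (auto simp: left_perp_def)
  ultimately have "left_perp T {B} = U" using cover B(1) by blast
  then obtain h where h: "h \<in> Hom X B" "h \<noteq> cat_zero A X B"
    using X by (auto simp: left_perp_def)
  obtain I Q e m c where s: "e \<in> Hom X I" "is_epi A e" "m \<in> Hom I B" "is_mono A m" "m \<cdot> e = h"
    "I \<in> W"
    using ex_image_sequence_wide[OF h(1)] T_sub_W B(1) X(1) by metis
  have "I \<in> T" using tors_quotient[OF T s(2,1) X(1) s(6)] .
  moreover have "I \<notin> U"
    using hom_U_B[OF _ s(3)] h(2) s(5) comp_zero_left[OF s(1) HomD(2)[OF s(3)]] by metis
  ultimately have "is_iso A m" using B_min mono_iso_or_len_less[OF s(4,3)] by fastforce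
  then have "is_epi A h" using is_epi_comp[OF s(1,3,2)] is_iso_imp_epi s(5) by blast
  then show thesis using that h(1) by blast
qed

text \<open>
  Let \<open>F\<close> be the class of objects of \<open>W\<close> receiving only zero maps from \<open>U\<close> and \<open>B\<close>. The objects
  of \<open>T\<close> without nonzero maps to \<open>F\<close> form a torsion class containing \<open>U\<close> and \<open>B\<close>, which is
  therefore \<open>T\<close>. So an object in both \<open>T\<close> and \<open>F\<close> has zero identity.
\<close>

lemma ex_nonzero_map_into:
  assumes X: "X \<in> T" "\<not> is_zero_object A X"
  obtains V h where "V \<in> insert B U" "h \<in> Hom V X" "h \<noteq> cat_zero A V X"
proof -
  define F where "F = {Y \<in> W. \<forall>V \<in> insert B U. \<forall>h \<in> Hom V Y. h = cat_zero A V Y}"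
  have "F \<subseteq> W" by (auto simp: F_def)
  then have "left_perp T F \<in> tors (full_subcat A W)" using left_perp_tors[OF T] by blast
  moreover have sub: "insert B U \<subseteq> left_perp T F"
    using UT B(1) by (auto simp: left_perp_def F_def)
  moreover have "left_perp T F \<subseteq> T" by (auto simp: left_perp_def)
  ultimately have "left_perp T F = T" using cover[of "left_perp T F"] B(2) by blast
  moreover have "cat_id A X \<noteq> cat_zero A X X" "cat_id A X \<in> Hom X X"
    using id_nonzero[OF _ X(2)] id_hom wide_obj T_sub_W X(1) by auto
  ultimately have "X \<notin> F" using X(1) unfolding left_perp_def by blast
  then show thesis using that X(1) T_sub_W by (auto simp: F_def)
qed

text \<open>
  A shortest object \<open>X\<close> of \<open>C\<close> outside \<open>U\<close> receives no nonzero maps from \<open>U\<close>: the cokernel of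
  such a map would be a shorter object of \<open>C\<close>, hence in \<open>U\<close>, making \<open>X\<close> an extension of objects
  of \<open>U\<close>. Therefore it receives a nonzero map from \<open>B\<close>, which must be mono as its image cannot lie
  in \<open>U\<close>. Since \<open>X\<close> also has \<open>B\<close> as a quotient, \<open>B\<close> is the image of an endomorphism of \<open>X\<close>.
\<close>

lemma B_in_ICE_closed:
  assumes C: "ICE_closed A C" "U \<subseteq> C" "C \<subseteq> T" "C \<noteq> U"
  shows "B \<in> C"
proof -
  obtain X0 where "X0 \<in> C \<and> X0 \<notin> U" using C by blast
  from ex_has_least_nat[of "\<lambda>X. X \<in> C \<and> X \<notin> U", OF this, of len]
  obtain X where X: "X \<in> C" "X \<notin> U" and min: "\<And>Y. \<lbrakk>Y \<in> C; Y \<notin> U\<rbrakk> \<Longrightarrow> len X \<le> len Y" by blast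
  have XT: "X \<in> T" using X C by blast
  have UX: "h = cat_zero A V X" if V: "V \<in> U" and h: "h \<in> Hom V X" for V h
  proof (rule ccontr)
    assume nz: "h \<noteq> cat_zero A V X"
    obtain I Q e m c where s: "e \<in> Hom V I" "is_epi A e" "m \<in> Hom I X"
      "c \<in> Hom X Q" "is_epi A c" "is_cokernel A h c" "short_exact A m c" "I \<in> W"
      using ex_image_sequence_wide[OF h U_sub_W[OF V] T_sub_W[OF XT]] by metis
    have "I \<in> U" using tors_quotient[OF U s(2,1) V s(8)] .
    have "Q \<in> C"
      using C V X(1) s(6) HomD[OF h] HomD[OF s(4)]
      unfolding ICE_closed_def cokernel_closed_def by (metis subsetD)
    moreover have "\<not> is_iso A c"
      using mono_comp_zero[OF is_iso_imp_mono s(4) h] is_cokernelD(2)[OF s(6) h] nz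
        HomD[OF s(4)] by metis
    ultimately have "Q \<in> U" using epi_iso_or_len_less[OF s(5,4)] min by fastforce
    then show False using tors_extension[OF U s(7,3,4) \<open>I \<in> U\<close>] X(2) by blast
  qed
  have "\<not> is_zero_object A X" using tors_zero[OF U] X(2) by blast
  then obtain h where h: "h \<in> Hom B X" "h \<noteq> cat_zero A B X"
    using ex_nonzero_map_into[OF XT] UX by blast
  have h_mono: "is_mono A h"
  proof -
    obtain I Q e m c where s: "e \<in> Hom B I" "is_epi A e" "m \<in> Hom I X" "is_mono A m" "m \<cdot> e = h"
      "I \<in> W"
      using ex_image_sequence_wide[OF h(1)] T_sub_W XT B(1) by metis
    have "I \<notin> U" using UX[OF _ s(3)] h(2) s(5) comp_zero_left[OF s(1) HomD(2)[OF s(3)]] by metis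
    then have "is_mono A e" using quotient_of_B[OF s(2,1,6)] is_iso_imp_mono by blast
    then show ?thesis using is_mono_comp[OF s(1,3) _ s(4)] s(5) by blast
  qed
  obtain \<phi> where \<phi>: "\<phi> \<in> Hom X B" "is_epi A \<phi>" using ex_epi_to_B[OF XT X(2)] .
  have h\<phi>: "h \<cdot> \<phi> \<in> Hom X X" using comp_hom \<phi>(1) h(1) by blast
  obtain c where c: "is_cokernel A (h \<cdot> \<phi>) c" using ex_cokernel HomD[OF h\<phi>] by blast
  have "is_cokernel A h c" using is_cokernel_precomp_epi[OF \<phi> h(1) c] .
  then have "is_image A (h \<cdot> \<phi>) h"
    using c mono_kernel_of_cokernel[OF h_mono h(1)] by (auto simp: is_image_def)
  then show ?thesis
    using C(1) X(1) HomD[OF h\<phi>] HomD[OF h(1)]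
    unfolding ICE_closed_def image_closed_def by metis
qed

text \<open>
  By induction on length, every object of \<open>T\<close> is built by extensions from objects of \<open>U\<close> and
  copies of \<open>B\<close>: the image of a nonzero map from one of these is another one of them.
\<close>

lemma T_subset_ICE_closed:
  assumes C: "ICE_closed A C" "U \<subseteq> C" "B \<in> C"
  shows "T \<subseteq> C"
proof
  fix X assume "X \<in> T"
  then show "X \<in> C"
  proof (induction "len X" arbitrary: X rule: less_induct)
    case less
    show ?case
    proof (cases "is_zero_object A X")
      case True
      then show ?thesis using tors_zero[OF U] C(2) by blast
    next
      case False
      obtain V h where h: "V \<in> insert B U" "h \<in> Hom V X" "h \<noteq> cat_zero A V X"
        using ex_nonzero_map_into[OF less.prems False] .
      have VT: "V \<in> T" using h(1) UT B(1) by blast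
      obtain I Q e m c where s: "e \<in> Hom V I" "is_epi A e" "m \<in> Hom I X"
        "c \<in> Hom X Q" "is_epi A c" "is_cokernel A h c" "short_exact A m c" "I \<in> W" "Q \<in> W"
        using ex_image_sequence_wide[OF h(2)] T_sub_W less.prems VT by metis
      have "I \<in> C"
      proof (cases "V = B")
        case True
        then have "is_iso A e \<or> I \<in> U" using quotient_of_B[OF s(2)] s(1,8) by blast
        then show ?thesis
          using C True HomD[OF s(1)] unfolding ICE_closed_def subcategory_def by blast
      next
        case False
        then show ?thesis using tors_quotient[OF U s(2,1) _ s(8)] h(1) C(2) by blast
      qed
      have "\<not> is_iso A c"
        using mono_comp_zero[OF is_iso_imp_mono s(4) h(2)] is_cokernelD(2)[OF s(6) h(2)] h(3)
          HomD[OF s(4)] by metis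
      then have "Q \<in> C"
        using epi_iso_or_len_less[OF s(5,4)] less.hyps tors_quotient[OF T s(5,4) less.prems s(9)]
        by blast
      then show ?thesis
        using C(1) s(7) \<open>I \<in> C\<close> HomD[OF s(3)] HomD[OF s(4)]
        unfolding ICE_closed_def extension_closed_def by metis
    qed
  qed
qed

end

theorem (in abelian_length_category) ICE_closed_between_cover:
  assumes W: "wide_subcategory A W"
    and T: "T \<in> tors (full_subcat A W)" and U: "U \<in> tors (full_subcat A W)" and UT: "U \<subset> T"
    and cover: "\<not> (\<exists>R \<in> tors (full_subcat A W). U \<subset> R \<and> R \<subset> T)"
    and C: "ICE_closed A C" "U \<subseteq> C" "C \<subseteq> T"
  shows "C = U \<or> C = T"
proof (cases "C = U")
  case False
  obtain B0 where "B0 \<in> T \<and> B0 \<notin> U" using UT by blast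
  from ex_has_least_nat[of "\<lambda>X. X \<in> T \<and> X \<notin> U", OF this, of len]
  obtain B where B: "B \<in> T" "B \<notin> U" "\<And>Y. \<lbrakk>Y \<in> T; Y \<notin> U\<rbrakk> \<Longrightarrow> len B \<le> len Y" by blast
  interpret wide_in_abelian_category A W
    by unfold_locales (rule W)
  interpret torsion_class_cover A W T U B
    using T U UT cover B by unfold_locales blast+
  show ?thesis
    using T_subset_ICE_closed[OF C(1,2) B_in_ICE_closed[OF C False]] C(3) by blast
qed simp


section \<open>Comparison of the Hasse quivers\<close>

lemma induced_subgraph_hasse_quiver:
  assumes "P \<subseteq> Q"
    and between: "\<And>p q r. \<lbrakk>p \<in> P; q \<in> P; q < p; r \<in> Q; q < r; r < p\<rbrakk> \<Longrightarrow> \<exists>r' \<in> P. q < r' \<and> r' < p"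
  shows "induced_subgraph (hasse_quiver P) (hasse_quiver Q)"
proof -
  have "wf_digraph (hasse_quiver R)" for R :: "'a set"
    by unfold_locales (auto simp: hasse_quiver_def)
  moreover have "verts (hasse_quiver R) = R" "tail (hasse_quiver R) = fst" "head (hasse_quiver R) = snd"
    for R :: "'a set"
    by (simp_all add: hasse_quiver_def)
  moreover have "arcs (hasse_quiver P) = {e \<in> arcs (hasse_quiver Q). fst e \<in> P \<and> snd e \<in> P}"
  proof -
    have "(\<exists>r \<in> P. q < r \<and> r < p) \<longleftrightarrow> (\<exists>r \<in> Q. q < r \<and> r < p)"
      if "p \<in> P" "q \<in> P" "q < p" for p q
      using between[OF that] assms(1) by (meson subsetD)
    then show ?thesis using assms(1) by (auto simp: hasse_quiver_def)
  qed
  ultimately show ?thesis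
    using assms(1) by (auto simp: induced_subgraph_def subgraph_def compatible_def)
qed

theorem proposition6p3:
  fixes A :: "('o, 'm) precat" and W :: "'o set"
  assumes "abelian_length_category A"
    and "wide_subcategory A W"
  shows "induced_subgraph (hasse_quiver (tors (full_subcat A W))) (hasse_quiver (ice A))
    \<and> tors (full_subcat A W) \<subseteq> ice A
    \<and> (\<forall>T \<in> tors (full_subcat A W). \<forall>U \<in> tors (full_subcat A W).
         (T, U) \<in> arcs (hasse_quiver (tors (full_subcat A W)))
         \<longleftrightarrow> (T, U) \<in> arcs (hasse_quiver (ice A)))"
proof -
  interpret abelian_length_category A by (rule assms(1))
  interpret wide_in_abelian_category A W by unfold_locales (rule assms(2))
  let ?P = "tors (full_subcat A W)"
  have "\<exists>R \<in> ?P. U \<subset> R \<and> R \<subset> T"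
    if "T \<in> ?P" "U \<in> ?P" "U \<subset> T" "C \<in> ice A" "U \<subset> C" "C \<subset> T" for T U C
    using ICE_closed_between_cover[OF assms(2) that(1,2,3), of C] that(4-6)
    by (auto simp: ice_def)
  then have sub: "induced_subgraph (hasse_quiver ?P) (hasse_quiver (ice A))"
    by (intro induced_subgraph_hasse_quiver tors_subset_ice)
  then have "arcs (hasse_quiver ?P) = {e \<in> arcs (hasse_quiver (ice A)). fst e \<in> ?P \<and> snd e \<in> ?P}"
    by (simp add: induced_subgraph_def hasse_quiver_def)
  then show ?thesis using sub tors_subset_ice by auto
qed

end
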